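(* For any $\varepsilon>0$ and any monotone summable property $\mathcal{P}$ of a proper minor-closed class $\mathcal{G}$, there are constants $r\ge 0$ and $K\ge 0$ such that $\mathcal{P}$ has an $r$-round $\varepsilon$-approximate proof labelling scheme of complexity at most $K$.
   Context: All graphs are finite and simple. A class of graphs is minor-closed if every minor of a graph in the class is in the class; it is proper if it does not contain all graphs. A property $\mathcal{P}$ of a class $\mathcal{G}$ is an isomorphism-closed class of graphs $\mathcal{P}\subseteq\mathcal{G}$; it is monotone if it is closed under taking (not necessarily induced) subgraphs, and summable if the disjoint union of any two graphs in $\mathcal{P}$ is also in $\mathcal{P}$. A graph $G$ is $\varepsilon$-far from $\mathcal{P}$ if $G\notin\mathcal{P}$ and one needs to modify at least $\varepsilon|E(G)|$ adjacencies of $G$ (replacing edges by non-edges and vice versa, on the vertex set of $G$) in order to obtain a graph in $\mathcal{P}$ (this graph need not be connected). Local certification. The instance graphs $G$ to be certified are connected, and the vertices of an $n$-vertex instance are assigned distinct but otherwise arbitrary identifiers from $\{1,\dots,\mathrm{poly}(n)\}$ (for some fixed polynomial); instances are considered as labelled by these identifiers, and so are their subgraphs. A proof for $G$ is a function $P:V(G)\to\{0,1\}^*$ (it may depend on the identifiers); its size is the maximum length of a certificate $P(v)$, $v\in V(G)$. A verifier $\mathcal{A}$ is a function taking a (labelled) graph $G$, a proof $P$ for $G$ and a vertex $v\in V(G)$ and returning an element of $\{0,1\}$. Let $B_r(v)$ be the set of vertices at distance at most $r$ from $v$ in $G$, let $G[v,r]$ be the subgraph of $G$ induced by $B_r(v)$,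 and let $P[v,r]$ be the restriction of $P$ to $B_r(v)$. The verifier $\mathcal{A}$ is local with local horizon at most $r$ if $\mathcal{A}(G,P,v)=\mathcal{A}(G[v,r],P[v,r],v)$ for all $G,P,v$. An $r$-round $\varepsilon$-approximate proof labelling scheme for $\mathcal{P}$ is a pair consisting of a prover, which maps each instance $G\in\mathcal{P}$ to a proof $P_G$ for $G$, and a local verifier $\mathcal{A}$ with local horizon at most $r$, such that: (completeness) if $G\in\mathcal{P}$, then $\mathcal{A}(G,P_G,v)=1$ for every $v\in V(G)$; (soundness) if $G$ is $\varepsilon$-far from $\mathcal{P}$, then for every proof $P'$ for $G$ there is a vertex $v\in V(G)$ with $\mathcal{A}(G,P',v)=0$. The complexity of the scheme is the maximum size of the proof $P_G$ over $n$-vertex instances $G\in\mathcal{P}$ (as a function of $n$); complexity at most $K$ means this is at most $K$ for all $n$. *)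

theory Defs
  imports Complex_Main "HOL-Library.Extended_Nat" "HOL-Computational_Algebra.Polynomial"
begin

section \<open>Finite simple graphs\<close>

record 'a ugraph =
  verts :: "'a set"
  edges :: "'a set set"

definition simple_graph :: "'a ugraph \<Rightarrow> bool" where
  "simple_graph G \<longleftrightarrow> finite (verts G) \<and> (\<forall>e \<in> edges G. e \<subseteq> verts G \<and> card e = 2)"

definition subgraph :: "'a ugraph \<Rightarrow> 'a ugraph \<Rightarrow> bool" where
  "subgraph H G \<longleftrightarrow> simple_graph H \<and> simple_graph G \<and> verts H \<subseteq> verts G \<and> edges H \<subseteq> edges G"

definition induced :: "'a ugraph \<Rightarrow> 'a set \<Rightarrow> 'a ugraph" where
  "induced G X = \<lparr> verts = verts G \<inter> X, edges = {e \<in> edges G. e \<subseteq> X} \<rparr>"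

definition graph_union :: "'a ugraph \<Rightarrow> 'a ugraph \<Rightarrow> 'a ugraph" where
  "graph_union G H = \<lparr> verts = verts G \<union> verts H, edges = edges G \<union> edges H \<rparr>"

definition isomorphic :: "'a ugraph \<Rightarrow> 'b ugraph \<Rightarrow> bool" where
  "isomorphic G H \<longleftrightarrow> simple_graph G \<and> simple_graph H \<and>
     (\<exists>f. bij_betw f (verts G) (verts H) \<and>
          (\<forall>u \<in> verts G. \<forall>v \<in> verts G. {u, v} \<in> edges G \<longleftrightarrow> {f u, f v} \<in> edges H))"

definition adj_rel :: "'a ugraph \<Rightarrow> ('a \<times> 'a) set" where
  "adj_rel G = {(u, v). {u, v} \<in> edges G}"

definition connected_graph :: "'a ugraph \<Rightarrow> bool" where
  "connected_graph G \<longleftrightarrow> verts G \<noteq> {} \<and>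
     (\<forall>u \<in> verts G. \<forall>v \<in> verts G. (u, v) \<in> (adj_rel G)\<^sup>*)"

text \<open>The least length of a walk from \<open>u\<close> to \<open>v\<close>; it is \<open>\<infinity>\<close> if there is none.\<close>
definition gdist :: "'a ugraph \<Rightarrow> 'a \<Rightarrow> 'a \<Rightarrow> enat" where
  "gdist G u v = (INF n \<in> {n. (u, v) \<in> adj_rel G ^^ n}. enat n)"

definition gball :: "'a ugraph \<Rightarrow> 'a \<Rightarrow> nat \<Rightarrow> 'a set" where
  "gball G v r = {u \<in> verts G. gdist G v u \<le> enat r}"

text \<open>Minors are described by their branch sets: pairwise disjoint connected (hence nonempty)
  vertex sets \<open>B x\<close> in \<open>G\<close>, one for each vertex \<open>x\<close> of \<open>H\<close>, such that every edge of \<open>H\<close> is realised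
  by an edge of \<open>G\<close> between the corresponding branch sets. In particular, this notion is
  invariant under isomorphism of \<open>H\<close>.\<close>
definition minor :: "'b ugraph \<Rightarrow> 'a ugraph \<Rightarrow> bool" where
  "minor H G \<longleftrightarrow> simple_graph H \<and> simple_graph G \<and>
     (\<exists>B. (\<forall>x \<in> verts H. B x \<subseteq> verts G \<and> connected_graph (induced G (B x))) \<and>
          (\<forall>x \<in> verts H. \<forall>y \<in> verts H. x \<noteq> y \<longrightarrow> B x \<inter> B y = {}) \<and>
          (\<forall>x y. {x, y} \<in> edges H \<longrightarrow> (\<exists>u \<in> B x. \<exists>v \<in> B y. {u, v} \<in> edges G)))"


section \<open>Graph classes and properties\<close>

text \<open>Every finite graph has an isomorphic copy with vertices in \<open>\<nat>\<close>, so isomorphism-closed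
  classes of finite simple graphs are represented by sets of graphs on natural numbers. A natural
  number used as a vertex is at the same time the identifier of that vertex.\<close>
type_synonym lgraph = "nat ugraph"

definition graph_class :: "lgraph set \<Rightarrow> bool" where
  "graph_class \<C> \<longleftrightarrow> (\<forall>G \<in> \<C>. simple_graph G) \<and>
     (\<forall>G \<in> \<C>. \<forall>H :: lgraph. isomorphic G H \<longrightarrow> H \<in> \<C>)"

definition minor_closed :: "lgraph set \<Rightarrow> bool" where
  "minor_closed \<C> \<longleftrightarrow> (\<forall>G \<in> \<C>. \<forall>H :: lgraph. minor H G \<longrightarrow> H \<in> \<C>)"

definition proper_class :: "lgraph set \<Rightarrow> bool" where
  "proper_class \<C> \<longleftrightarrow> (\<exists>G. simple_graph G \<and> G \<notin> \<C>)"

definition property_of :: "lgraph set \<Rightarrow> lgraph set \<Rightarrow> bool" where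
  "property_of \<P> \<C> \<longleftrightarrow> graph_class \<P> \<and> \<P> \<subseteq> \<C>"

definition monotone_property :: "lgraph set \<Rightarrow> bool" where
  "monotone_property \<P> \<longleftrightarrow> (\<forall>G \<in> \<P>. \<forall>H. subgraph H G \<longrightarrow> H \<in> \<P>)"

text \<open>Since properties are closed under isomorphism, it suffices to speak about the union of
  graphs whose vertex sets are already disjoint.\<close>
definition summable_property :: "lgraph set \<Rightarrow> bool" where
  "summable_property \<P> \<longleftrightarrow>
     (\<forall>G \<in> \<P>. \<forall>H \<in> \<P>. verts G \<inter> verts H = {} \<longrightarrow> graph_union G H \<in> \<P>)"

definition eps_far :: "real \<Rightarrow> lgraph set \<Rightarrow> lgraph \<Rightarrow> bool" where
  "eps_far \<epsilon> \<P> G \<longleftrightarrow> G \<notin> \<P> \<and>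
     (\<forall>H \<in> \<P>. verts H = verts G \<longrightarrow>
        \<epsilon> * real (card (edges G)) \<le> real (card ((edges G - edges H) \<union> (edges H - edges G))))"


section \<open>Local certification\<close>

text \<open>The polynomial \<open>p\<close> bounds the range of the identifiers.\<close>
definition certification_instance :: "real poly \<Rightarrow> lgraph \<Rightarrow> bool" where
  "certification_instance p G \<longleftrightarrow> simple_graph G \<and> connected_graph G \<and>
     (\<forall>v \<in> verts G. 1 \<le> v \<and> real v \<le> poly p (real (card (verts G))))"

text \<open>A proof is a partial map, so that its restriction to a ball carries no information about
  certificates outside the ball.\<close>
type_synonym cert_proof = "nat \<rightharpoonup> bool list"

definition proof_for :: "lgraph \<Rightarrow> cert_proof \<Rightarrow> bool" where
  "proof_for G P \<longleftrightarrow> dom P = verts G"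

definition proof_size :: "lgraph \<Rightarrow> cert_proof \<Rightarrow> nat" where
  "proof_size G P = Max ((\<lambda>v. length (the (P v))) ` verts G)"

type_synonym verifier = "lgraph \<Rightarrow> cert_proof \<Rightarrow> nat \<Rightarrow> bool"

type_synonym prover = "lgraph \<Rightarrow> cert_proof"

definition local_verifier :: "nat \<Rightarrow> verifier \<Rightarrow> bool" where
  "local_verifier r \<A> \<longleftrightarrow>
     (\<forall>G P v. simple_graph G \<and> proof_for G P \<and> v \<in> verts G \<longrightarrow>
        \<A> G P v = \<A> (induced G (gball G v r)) (P |` gball G v r) v)"

definition approx_pls ::
    "real poly \<Rightarrow> real \<Rightarrow> lgraph set \<Rightarrow> nat \<Rightarrow> prover \<Rightarrow> verifier \<Rightarrow> bool" where
  "approx_pls p \<epsilon> \<P> r prv \<A> \<longleftrightarrow>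
     local_verifier r \<A> \<and>
     (\<forall>G \<in> \<P>. certification_instance p G \<longrightarrow>
        proof_for G (prv G) \<and> (\<forall>v \<in> verts G. \<A> G (prv G) v)) \<and>
     (\<forall>G. certification_instance p G \<and> eps_far \<epsilon> \<P> G \<longrightarrow>
        (\<forall>P. proof_for G P \<longrightarrow> (\<exists>v \<in> verts G. \<not> \<A> G P v)))"

text \<open>As a supremum in \<open>enat\<close>, this is \<open>0\<close> for those \<open>n\<close> for which \<open>\<P>\<close> has no instance with
  \<open>n\<close> vertices.\<close>
definition scheme_complexity :: "real poly \<Rightarrow> lgraph set \<Rightarrow> prover \<Rightarrow> nat \<Rightarrow> enat" where
  "scheme_complexity p \<P> prv n =
     (SUP G \<in> {G \<in> \<P>. certification_instance p G \<and> card (verts G) = n}.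
        enat (proof_size G (prv G)))"

end

theory Submission
  imports Defs
begin

text \<open>The certificates encode a bounded family of colourings produced by the chopping procedure of
  Klein, Plotkin and Rao: in each of \<open>s\<close> rounds every monochromatic component is cut into bands of
  \<open>l\<close> consecutive breadth-first layers, and the new colour bit of a vertex is the parity of its band.
  Running over all \<open>l ^ s\<close> choices of offsets, each edge is cut in at most a fraction \<open>s / l\<close> of the
  colourings. This can be checked locally, so for graphs passing the test an averaging argument
  yields one colouring that cuts few edges, and its monochromatic components, which have bounded
  weak diameter and can therefore be inspected by the verifier, sum up to a graph in \<open>\<P>\<close>.

  The weak diameter is bounded because otherwise the nested components \<open>V\<^sub>0 \<supseteq> V\<^sub>1 \<supseteq> \<dots> \<supseteq> V\<^sub>s\<close> give
  a model of \<open>K\<^bsub>s,s\<^esub>\<close>. Take \<open>s\<close> vertices of \<open>V\<^sub>s\<close> that are pairwise far apart in \<open>G\<close>. Going from the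
  inside outwards, extend the \<open>s\<close> small branch sets around them by breadth-first descents in \<open>V\<^sub>j\<close>
  that end \<open>2 l\<close> layers below the band containing \<open>V\<^bsub>j+1\<^esub>\<close>; the ball of \<open>V\<^sub>j\<close> below that is a new branch
  set on the other side. A descent starting in \<open>V\<^bsub>j+1\<^esub>\<close> stays in \<open>V\<^bsub>j+1\<^esub>\<close> until it leaves the band, which
  takes fewer than \<open>l\<close> steps, so it misses the old branch sets if its starting point has distance at
  least \<open>l\<close> from them inside \<open>V\<^bsub>j+1\<^esub>\<close>. The vertex \<open>l\<close> layers below the previous band is such a point.\<close>

section \<open>Weak diameter of iterated bands\<close>

definition conn :: "('a \<times> 'a) set \<Rightarrow> 'a set \<Rightarrow> bool" where
  "conn E B \<longleftrightarrow> B \<noteq> {} \<and> (\<forall>u\<in>B. \<forall>v\<in>B. (u, v) \<in> (E \<inter> B \<times> B)\<^sup>*)"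

text \<open>For symmetric \<open>E\<close>, this pins down \<open>d\<close> on \<open>W\<close> as
  the distance from \<open>x\<close> in the graph induced on \<open>W\<close>: the Lipschitz clause
  bounds \<open>d\<close> by the length of any walk, the parent clause provides a walk of length
  \<open>d v\<close>.\<close>

definition bfs :: "('a \<times> 'a) set \<Rightarrow> 'a set \<Rightarrow> 'a \<Rightarrow> ('a \<Rightarrow> nat) \<Rightarrow> bool" where
  "bfs E W x d \<longleftrightarrow> x \<in> W \<and> (\<forall>v\<in>W. d v = 0 \<longleftrightarrow> v = x) \<and>
     (\<forall>u\<in>W. \<forall>v\<in>W. (u, v) \<in> E \<longrightarrow> d v \<le> Suc (d u)) \<and>
     (\<forall>v\<in>W. d v > 0 \<longrightarrow> (\<exists>u\<in>W. (v, u) \<in> E \<and> Suc (d u) = d v))"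

lemma conn_singleton: "conn E {x}"
  by (auto simp: conn_def)

lemma connI_center:
  assumes "sym E" "a \<in> B" "\<And>u. u \<in> B \<Longrightarrow> (u, a) \<in> (E \<inter> B \<times> B)\<^sup>*"
  shows "conn E B"
proof -
  have "sym (E \<inter> B \<times> B)"
    using assms(1) by (auto simp: sym_def)
  then have "(a, u) \<in> (E \<inter> B \<times> B)\<^sup>*" if "u \<in> B" for u
    using assms(3)[OF that] sym_rtrancl symD by metis
  then show ?thesis
    unfolding conn_def using assms(2,3) rtrancl_trans by (metis empty_iff)
qed

lemma conn_rtrancl_superset:
  assumes "conn E A" "u \<in> A" "v \<in> A" "A \<subseteq> B"
  shows "(u, v) \<in> (E \<inter> B \<times> B)\<^sup>*"
proof -
  have "E \<inter> A \<times> A \<subseteq> E \<inter> B \<times> B"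
    using assms(4) by auto
  then show ?thesis
    using assms(1-3) rtrancl_mono unfolding conn_def by blast
qed

lemma conn_Un:
  assumes "sym E" "conn E A" "conn E B" "a \<in> A" "b \<in> B" "(a, b) \<in> E"
  shows "conn E (A \<union> B)"
proof (rule connI_center[OF assms(1)])
  show "a \<in> A \<union> B" using assms by simp
  have "(b, a) \<in> E \<inter> (A \<union> B) \<times> (A \<union> B)"
    using assms symD[OF assms(1,6)] by simp
  then show "(u, a) \<in> (E \<inter> (A \<union> B) \<times> (A \<union> B))\<^sup>*" if "u \<in> A \<union> B" for u
    using that conn_rtrancl_superset[OF assms(2) _ assms(4), of u "A \<union> B"]
      conn_rtrancl_superset[OF assms(3) _ assms(5), of u "A \<union> B"]
    by (auto intro: rtrancl.rtrancl_into_rtrancl)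
qed

lemma conn_Un_inter:
  assumes "sym E" "conn E A" "conn E B" "a \<in> A" "a \<in> B"
  shows "conn E (A \<union> B)"
proof (rule connI_center[OF assms(1)])
  show "a \<in> A \<union> B" using assms by simp
  show "(u, a) \<in> (E \<inter> (A \<union> B) \<times> (A \<union> B))\<^sup>*" if "u \<in> A \<union> B" for u
    using that conn_rtrancl_superset[OF assms(2) _ assms(4), of u "A \<union> B"]
      conn_rtrancl_superset[OF assms(3) _ assms(5), of u "A \<union> B"] by auto
qed

lemma conn_path:
  fixes p :: "nat \<Rightarrow> 'a"
  assumes "sym E" "\<And>i. i < n \<Longrightarrow> (p i, p (Suc i)) \<in> E"
  shows "conn E (p ` {..n})"
  using assms(2)
proof (induction n)
  case 0
  then show ?case by (simp add: conn_singleton)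
next
  case (Suc n)
  have "conn E (p ` {..n} \<union> {p (Suc n)})"
    by (rule conn_Un[OF assms(1) _ conn_singleton, where a = "p n"]) (use Suc in auto)
  then show ?case
    by (simp add: atMost_Suc)
qed

lemma bfs_descent:
  assumes "bfs E W x d" "v \<in> W"
  obtains p where "p 0 = v" "\<And>i. i \<le> d v \<Longrightarrow> p i \<in> W \<and> d (p i) = d v - i"
    "\<And>i. i < d v \<Longrightarrow> (p i, p (Suc i)) \<in> E" "p (d v) = x"
proof -
  have "\<forall>y\<in>W. d y > 0 \<longrightarrow> (\<exists>u\<in>W. (y, u) \<in> E \<and> Suc (d u) = d y)"
    using assms by (auto simp: bfs_def)
  then obtain par where par: "par y \<in> W \<and> (y, par y) \<in> E \<and> Suc (d (par y)) = d y"
    if "y \<in> W" "d y > 0" for y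
    by metis
  have mem: "(par ^^ i) v \<in> W \<and> d ((par ^^ i) v) = d v - i" if "i \<le> d v" for i
    using that
  proof (induction i)
    case (Suc i)
    then show ?case
      using par[of "(par ^^ i) v"] by (simp add: Suc_diff_le) linarith
  qed (use assms in simp)
  moreover have "((par ^^ i) v, (par ^^ Suc i) v) \<in> E" if "i < d v" for i
    using par[of "(par ^^ i) v"] mem[of i] that by simp
  moreover have "(par ^^ d v) v = x"
    using mem[of "d v"] assms(1) unfolding bfs_def by auto
  ultimately show thesis
    by (intro that[of "\<lambda>i. (par ^^ i) v"]) auto
qed

text \<open>Each step of a descent lowers \<open>d\<close>, so the descent from a vertex of the ball
  to \<open>x\<close> stays in the ball.\<close>

lemma bfs_ball_conn:
  assumes "sym E" "bfs E W x d" "h > 0"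
  shows "conn E {y \<in> W. d y < h}" (is "conn E ?B")
proof -
  have to_x: "(y, x) \<in> (E \<inter> ?B \<times> ?B)\<^sup>*" if y: "y \<in> ?B" for y
  proof -
    have "y \<in> W" using y by simp
    then obtain p where p: "p 0 = y" "\<And>i. i \<le> d y \<Longrightarrow> p i \<in> W \<and> d (p i) = d y - i"
      "\<And>i. i < d y \<Longrightarrow> (p i, p (Suc i)) \<in> E" "p (d y) = x"
      using bfs_descent[OF assms(2)] by metis
    have "(y, p i) \<in> (E \<inter> ?B \<times> ?B)\<^sup>*" if "i \<le> d y" for i
      using that
    proof (induction i)
      case (Suc i)
      have "(p i, p (Suc i)) \<in> E \<inter> ?B \<times> ?B"
        using p(2)[of i] p(2)[of "Suc i"] p(3)[of i] Suc.prems y by auto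
      then show ?case
        using Suc by (auto intro: rtrancl.rtrancl_into_rtrancl)
    qed (simp add: p(1))
    then show ?thesis using p(4) by auto
  qed
  have "x \<in> ?B"
    using assms(2,3) by (auto simp: bfs_def)
  then show ?thesis
    by (rule connI_center[OF assms(1) _ to_x])
qed

lemma bfs_relpow_Lipschitz:
  assumes "sym E" "bfs E W x d" "(u, v) \<in> (E \<inter> W \<times> W) ^^ n"
  shows "d v \<le> d u + n \<and> d u \<le> d v + n"
  using assms(3)
proof (induction n arbitrary: v)
  case (Suc n)
  then obtain y where y: "(u, y) \<in> (E \<inter> W \<times> W) ^^ n" "(y, v) \<in> E \<inter> W \<times> W"
    by auto
  have "(v, y) \<in> E"
    using y(2) assms(1) by (meson IntD1 symD)
  then have "d v \<le> Suc (d y)" "d y \<le> Suc (d v)"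
    using y(2) assms(2) unfolding bfs_def by blast+
  then show ?case
    using Suc.IH[OF y(1)] by simp
qed simp

text \<open>A model of \<open>K\<^bsub>m,N\<^esub>\<close> inside \<open>V\<close>. The branch sets \<open>S k\<close> are kept apart by the values of a
  Lipschitz function \<open>g\<close>; the last condition lets a descent from \<open>w k\<close> leave \<open>V\<close> without
  meeting any \<open>R i\<close>.\<close>
definition bipartite_model ::
    "('a \<times> 'a) set \<Rightarrow> nat \<Rightarrow> ('a \<Rightarrow> int) \<Rightarrow> int \<Rightarrow> nat \<Rightarrow> int \<Rightarrow> 'a set \<Rightarrow> nat \<Rightarrow>
      (nat \<Rightarrow> 'a set) \<Rightarrow> (nat \<Rightarrow> 'a) \<Rightarrow> (nat \<Rightarrow> 'a set) \<Rightarrow> bool" where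
  "bipartite_model E l g \<Delta> N \<rho> V m S w R \<longleftrightarrow>
     (\<forall>k<N. S k \<subseteq> V \<and> conn E (S k) \<and> w k \<in> S k \<and> (\<forall>x\<in>S k. \<bar>g x - int k * \<Delta>\<bar> \<le> \<rho>)) \<and>
     (\<forall>i<m. R i \<subseteq> V \<and> conn E (R i)) \<and>
     (\<forall>i<m. \<forall>j<m. i \<noteq> j \<longrightarrow> R i \<inter> R j = {}) \<and>
     (\<forall>i<m. \<forall>k<N. R i \<inter> S k = {} \<and> (\<exists>x\<in>R i. \<exists>y\<in>S k. (x, y) \<in> E)) \<and>
     (\<forall>k<N. \<forall>n<l. \<forall>i<m. \<forall>x\<in>R i. (w k, x) \<notin> (E \<inter> V \<times> V) ^^ n)"

lemma bipartite_modelD: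
  assumes "bipartite_model E l g \<Delta> N \<rho> V m S w R"
  shows "k < N \<Longrightarrow> S k \<subseteq> V" "k < N \<Longrightarrow> conn E (S k)" "k < N \<Longrightarrow> w k \<in> S k"
    "k < N \<Longrightarrow> y \<in> S k \<Longrightarrow> \<bar>g y - int k * \<Delta>\<bar> \<le> \<rho>"
    "i < m \<Longrightarrow> R i \<subseteq> V" "i < m \<Longrightarrow> conn E (R i)"
    "i < m \<Longrightarrow> j < m \<Longrightarrow> i \<noteq> j \<Longrightarrow> R i \<inter> R j = {}"
    "i < m \<Longrightarrow> k < N \<Longrightarrow> R i \<inter> S k = {}"
    "i < m \<Longrightarrow> k < N \<Longrightarrow> \<exists>x\<in>R i. \<exists>y\<in>S k. (x, y) \<in> E"
    "k < N \<Longrightarrow> n < l \<Longrightarrow> i < m \<Longrightarrow> x \<in> R i \<Longrightarrow> (w k, x) \<notin> (E \<inter> V \<times> V) ^^ n"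
  using assms unfolding bipartite_model_def by (elim conjE; meson)+

text \<open>\<open>V\<close> stands for one component of a band, not for full layers. Closure is
  demanded only for steps that do not increase \<open>d\<close>, the kind that a descent
  takes.\<close>

definition band ::
    "('a \<times> 'a) set \<Rightarrow> nat \<Rightarrow> 'a set \<Rightarrow> ('a \<Rightarrow> nat) \<Rightarrow> nat \<Rightarrow> 'a set \<Rightarrow> bool" where
  "band E l W d lo V \<longleftrightarrow> V \<subseteq> W \<and> (\<forall>v\<in>V. lo \<le> d v \<and> d v < lo + l) \<and>
     (\<forall>u\<in>V. \<forall>v\<in>W. (u, v) \<in> E \<longrightarrow> lo \<le> d v \<longrightarrow> d v \<le> d u \<longrightarrow> v \<in> V)"

section \<open>Extending a bipartite model across one band\<close>

lemma path_Lipschitz: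
  fixes g :: "'a \<Rightarrow> int"
  assumes "\<And>u v. (u, v) \<in> E \<Longrightarrow> \<bar>g u - g v\<bar> \<le> 1"
    and "\<And>i. i < n \<Longrightarrow> (p i, p (Suc i)) \<in> E" "i \<le> n"
  shows "\<bar>g (p i) - g (p 0)\<bar> \<le> int i"
  using assms(3)
proof (induction i)
  case (Suc i)
  then show ?case
    using assms(1)[OF assms(2)[of i]] by simp
qed simp

text \<open>A descent from the band to layer \<open>lo - 2 * l\<close> takes fewer than
  \<open>3 * l\<close> steps, which accounts for the growth of \<open>\<rho>\<close>. The bound on
  \<open>\<Delta>\<close> and the presence of two branch sets force \<open>lo > 2 * l\<close>, so
  that the ball serving as the new \<open>R m\<close> is nonempty.\<close>

lemma bipartite_model_extend:
  fixes g :: "'a \<Rightarrow> int"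
  assumes "sym E" and g: "\<And>u v. (u, v) \<in> E \<Longrightarrow> \<bar>g u - g v\<bar> \<le> 1"
    and bfs: "bfs E W x d" and band: "band E l W d lo V" and l: "l > 0"
    and model: "bipartite_model E l g \<Delta> N \<rho> V m S w R"
    and "\<Delta> > 2 * \<rho> + 6 * int l" and "N \<ge> 2"
  shows "\<exists>S w R. bipartite_model E l g \<Delta> N (\<rho> + 3 * int l) W (Suc m) S w R"
proof -
  note SV = bipartite_modelD(1)[OF model] and Sc = bipartite_modelD(2)[OF model]
    and wS = bipartite_modelD(3)[OF model] and Sg = bipartite_modelD(4)[OF model]
    and RV = bipartite_modelD(5)[OF model] and Rc = bipartite_modelD(6)[OF model]
    and RR = bipartite_modelD(7)[OF model] and RS = bipartite_modelD(8,9)[OF model]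
    and far = bipartite_modelD(10)[OF model]
  have wV: "w k \<in> V" if "k < N" for k
    using SV[OF that] wS[OF that] by blast
  have VW: "V \<subseteq> W" and Vd: "\<And>v. v \<in> V \<Longrightarrow> lo \<le> d v \<and> d v < lo + l"
    and Vcl: "\<And>u v. u \<in> V \<Longrightarrow> v \<in> W \<Longrightarrow> (u, v) \<in> E \<Longrightarrow> lo \<le> d v \<Longrightarrow> d v \<le> d u \<Longrightarrow> v \<in> V"
    using band unfolding band_def by (elim conjE; meson)+
  define descent where "descent k q \<longleftrightarrow> q 0 = w k \<and> (\<forall>i \<le> d (w k). q i \<in> W \<and> d (q i) = d (w k) - i) \<and>
      (\<forall>i < d (w k). (q i, q (Suc i)) \<in> E) \<and> q (d (w k)) = x" for k q
  have "\<exists>q. descent k q" if "k < N" for k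
    unfolding descent_def using bfs_descent[OF bfs subsetD[OF VW wV[OF that]]] by metis
  then obtain p where "\<And>k. k < N \<Longrightarrow> descent k (p k)"
    by metis
  then have p0: "\<And>k. k < N \<Longrightarrow> p k 0 = w k"
    and pW: "\<And>k i. k < N \<Longrightarrow> i \<le> d (w k) \<Longrightarrow> p k i \<in> W"
    and pd: "\<And>k i. k < N \<Longrightarrow> i \<le> d (w k) \<Longrightarrow> d (p k i) = d (w k) - i"
    and pE: "\<And>k i. k < N \<Longrightarrow> i < d (w k) \<Longrightarrow> (p k i, p k (Suc i)) \<in> E"
    and px: "\<And>k. k < N \<Longrightarrow> p k (d (w k)) = x"
    unfolding descent_def by simp_all
  have pg: "\<bar>g (p k i) - g (w k)\<bar> \<le> int i" if "k < N" "i \<le> d (w k)" for k i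
    using path_Lipschitz[of E g "d (w k)" "p k" i] g pE p0 that by auto
  \<comment> \<open>Otherwise \<open>w 0\<close> and \<open>w 1\<close> would both be close to the root \<open>x\<close>.\<close>
  have lo: "lo > 2 * l"
  proof (rule ccontr)
    assume "\<not> lo > 2 * l"
    then have "d (w 0) < 3 * l" "d (w 1) < 3 * l"
      using Vd[OF wV[of 0]] Vd[OF wV[of 1]] \<open>N \<ge> 2\<close> by auto
    moreover have "\<bar>g x - g (w 0)\<bar> \<le> int (d (w 0))" "\<bar>g x - g (w 1)\<bar> \<le> int (d (w 1))"
      using pg[of 0 "d (w 0)"] pg[of 1 "d (w 1)"] px[of 0] px[of 1] \<open>N \<ge> 2\<close> by auto
    moreover have "\<bar>g (w 0)\<bar> \<le> \<rho>" "\<bar>g (w 1) - \<Delta>\<bar> \<le> \<rho>"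
      using Sg[of 0 "w 0"] Sg[of 1 "w 1"] wS[of 0] wS[of 1] \<open>N \<ge> 2\<close> by auto
    ultimately show False
      using assms(7) by linarith
  qed
  define D where "D k = d (w k)" for k
  have D: "lo \<le> D k" "D k < lo + l" if "k < N" for k
    using Vd[OF wV[OF that]] by (auto simp: D_def)
  \<comment> \<open>The extension of \<open>S k\<close> ends in layer \<open>lo - 2 * l\<close> and
    \<open>B\<close> consists of the layers strictly below, so the next vertex of the descent gives
    the edge to \<open>B\<close>. The new \<open>w' k\<close> lies in layer \<open>lo - l\<close>,
    halfway between \<open>B\<close> and the band.\<close>
  define S' where "S' k = S k \<union> p k ` {..D k - (lo - 2 * l)}" for k
  define w' where "w' k = p k (D k - (lo - l))" for k
  define B where "B = {y \<in> W. d y < lo - 2 * l}"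
  define R' where "R' = R(m := B)"
  \<comment> \<open>Until it drops below layer \<open>lo\<close>, the descent is a walk inside
    \<open>V\<close>; only such walks are controlled by the last clause of the given model.\<close>
  have p_band: "p k i \<in> V \<and> (w k, p k i) \<in> (E \<inter> V \<times> V) ^^ i" if "k < N" "i \<le> D k - lo" for k i
    using that(2)
  proof (induction i)
    case 0
    show ?case using p0[OF that(1)] wV[OF that(1)] by simp
  next
    case (Suc i)
    have E: "(p k i, p k (Suc i)) \<in> E" using pE[of k i] Suc.prems that by (simp add: D_def)
    have i: "p k i \<in> V" "(w k, p k i) \<in> (E \<inter> V \<times> V) ^^ i"
      using Suc.IH Suc.prems by auto
    have "Suc i \<le> d (w k)" "lo \<le> d (w k) - Suc i"
      using Suc.prems D[OF that(1)] by (auto simp: D_def)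
    then have "p k (Suc i) \<in> V"
      using pW[OF that(1), of "Suc i"] pd[OF that(1), of "Suc i"] pd[OF that(1), of i]
      by (intro Vcl[OF i(1) _ E]) simp_all
    then show ?case
      using i E by auto
  qed
  have S'1: "S' k \<subseteq> W \<and> conn E (S' k) \<and> w' k \<in> S' k \<and>
      (\<forall>y\<in>S' k. \<bar>g y - int k * \<Delta>\<bar> \<le> \<rho> + 3 * int l)" if k: "k < N" for k
  proof (intro conjI ballI)
    show "S' k \<subseteq> W"
      using SV[OF k] VW pW[OF k] by (auto simp: S'_def D_def)
    show "conn E (S' k)"
      unfolding S'_def
    proof (rule conn_Un_inter[OF \<open>sym E\<close> Sc[OF k] _ wS[OF k]])
      show "conn E (p k ` {..D k - (lo - 2 * l)})"
        using pE[OF k] lo by (intro conn_path[OF \<open>sym E\<close>]) (simp add: D_def)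
      show "w k \<in> p k ` {..D k - (lo - 2 * l)}"
        by (rule image_eqI[of _ _ 0]) (simp_all add: p0[OF k])
    qed
    show "w' k \<in> S' k"
      by (auto simp: S'_def w'_def)
    fix y assume "y \<in> S' k"
    then consider "y \<in> S k" | i where "i \<le> D k - (lo - 2 * l)" "y = p k i"
      by (auto simp: S'_def)
    then show "\<bar>g y - int k * \<Delta>\<bar> \<le> \<rho> + 3 * int l"
    proof cases
      case 1
      then show ?thesis using Sg[OF k] by force
    next
      case 2
      then have "\<bar>g y - g (w k)\<bar> \<le> int i" "i \<le> 3 * l"
        using pg[OF k, of i] D[OF k] by (auto simp: D_def)
      then show ?thesis using Sg[OF k wS[OF k]] by linarith
    qed
  qed
  have R'1: "R' i \<subseteq> W \<and> conn E (R' i)" if "i < Suc m" for i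
    using that subset_trans[OF RV[of i] VW] Rc[of i] bfs_ball_conn[OF \<open>sym E\<close> bfs, of "lo - 2 * l"] lo
    by (cases "i = m") (simp_all add: R'_def B_def)
  have BV: "B \<inter> V = {}"
    using Vd by (fastforce simp: B_def)
  have R'2: "R' i \<inter> R' j = {}" if "i < Suc m" "j < Suc m" "i \<noteq> j" for i j
    using that RV[of i] RV[of j] RR[of i j] BV by (auto simp: R'_def less_Suc_eq)
  have R'S': "R' i \<inter> S' k = {} \<and> (\<exists>x\<in>R' i. \<exists>y\<in>S' k. (x, y) \<in> E)" if i: "i < Suc m" and k: "k < N" for i k
  proof (cases "i = m")
    case True
    have "p k j \<notin> B" if "j \<le> D k - (lo - 2 * l)" for j
      using pd[OF k, of j] that D[OF k] lo by (auto simp: B_def D_def)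
    moreover have "B \<inter> S k = {}" using BV SV[OF k] by auto
    moreover have "p k (Suc (D k - (lo - 2 * l))) \<in> B"
      using pd[OF k, of "Suc (D k - (lo - 2 * l))"] pW[OF k, of "Suc (D k - (lo - 2 * l))"] lo D[OF k]
      by (auto simp: B_def D_def)
    moreover have "(p k (Suc (D k - (lo - 2 * l))), p k (D k - (lo - 2 * l))) \<in> E"
      using symD[OF \<open>sym E\<close> pE[OF k, of "D k - (lo - 2 * l)"]] lo D[OF k] by (simp add: D_def)
    ultimately show ?thesis
      using True by (auto simp: R'_def S'_def)
  next
    case False
    then have im: "i < m" using i by simp
    \<comment> \<open>A hit would lie in \<open>V\<close>, so in a layer at least \<open>lo\<close>,
      and would thus be reached in fewer than \<open>l\<close> steps inside \<open>V\<close>, which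
      \<open>far\<close> excludes.\<close>
    have "p k j \<notin> R i" if j: "j \<le> D k - (lo - 2 * l)" for j
    proof
      assume pR: "p k j \<in> R i"
      then have "d (p k j) \<ge> lo" using RV[OF im] Vd by blast
      then have "j \<le> D k - lo" using pd[OF k, of j] j D[OF k] lo by (auto simp: D_def)
      moreover from this have "j < l" using D[OF k] by linarith
      ultimately show False using p_band[OF k] far[OF k _ im pR] by blast
    qed
    then show ?thesis
      using RS[OF im k] False by (auto simp: R'_def S'_def)
  qed
  \<comment> \<open>Fewer than \<open>l\<close> steps from layer \<open>lo - l\<close> reach only
    layers strictly between \<open>lo - 2 * l\<close> and \<open>lo\<close>, which meet neither
    \<open>B\<close> nor \<open>V\<close>.\<close>
  have "(w' k, y) \<notin> (E \<inter> W \<times> W) ^^ n" if k: "k < N" and "n < l" "i < Suc m" "y \<in> R' i" for k n i y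
  proof
    assume "(w' k, y) \<in> (E \<inter> W \<times> W) ^^ n"
    then have "d y \<le> d (w' k) + n \<and> d (w' k) \<le> d y + n"
      by (rule bfs_relpow_Lipschitz[OF \<open>sym E\<close> bfs])
    moreover have "d (w' k) = lo - l"
      using pd[OF k, of "D k - (lo - l)"] D[OF k] lo by (auto simp: w'_def D_def)
    ultimately have "lo - 2 * l < d y" "d y < lo"
      using lo \<open>n < l\<close> by auto
    then show False
      using that(3,4) RV[of i] Vd[of y] by (cases "i = m") (auto simp: R'_def B_def)
  qed
  then have "bipartite_model E l g \<Delta> N (\<rho> + 3 * int l) W (Suc m) S' w' R'"
    unfolding bipartite_model_def using S'1 R'1 R'2 R'S' by (intro conjI allI impI ballI) simp_all
  then show ?thesis by blast
qed

section \<open>Chains of bands and excluded minors\<close>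

inductive band_chain :: "('a \<times> 'a) set \<Rightarrow> nat \<Rightarrow> 'a set \<Rightarrow> nat \<Rightarrow> 'a set \<Rightarrow> bool"
  for E l V\<^sub>0 where
  base: "band_chain E l V\<^sub>0 0 V\<^sub>0"
| step: "band_chain E l V\<^sub>0 n W \<Longrightarrow> bfs E W x d \<Longrightarrow> band E l W d lo V
    \<Longrightarrow> band_chain E l V\<^sub>0 (Suc n) V"

text \<open>Each level costs \<open>3 * int l\<close> of slack in \<open>\<rho>\<close>. The
  hypothesis on \<open>\<Delta>\<close> is shaped so that one extension step turns it into the
  hypothesis for the shorter chain.\<close>

lemma band_chain_model:
  fixes g :: "'a \<Rightarrow> int"
  assumes "band_chain E l V\<^sub>0 n V"
    and "sym E" and "\<And>u v. (u, v) \<in> E \<Longrightarrow> \<bar>g u - g v\<bar> \<le> 1" and "l > 0" "N \<ge> 2"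
    and "bipartite_model E l g \<Delta> N \<rho> V m S w R"
    and "\<Delta> > 2 * \<rho> + 6 * int l * int (Suc n)"
  shows "\<exists>S w R. bipartite_model E l g \<Delta> N (\<rho> + 3 * int l * int n) V\<^sub>0 (m + n) S w R"
  using assms(1,6,7)
proof (induction arbitrary: m \<rho> S w R)
  case base
  then show ?case by auto
next
  case (step n W x d lo V)
  have "\<Delta> > 2 * \<rho> + 6 * int l"
    using step.prems(2) \<open>l > 0\<close> by (simp add: algebra_simps) (smt (verit) mult_nonneg_nonneg of_nat_0_le_iff)
  then obtain S' w' R' where "bipartite_model E l g \<Delta> N (\<rho> + 3 * int l) W (Suc m) S' w' R'"
    using bipartite_model_extend[OF assms(2,3) step.hyps(2,3) assms(4) step.prems(1) _ assms(5)] by blast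
  from step.IH[OF this] step.prems(2) show ?case
    by (auto simp: algebra_simps)
qed

lemma conn_intermediate_value:
  fixes g :: "'a \<Rightarrow> int"
  assumes "\<And>u v. (u, v) \<in> E \<Longrightarrow> \<bar>g u - g v\<bar> \<le> 1"
    and "conn E V" "u \<in> V" "v \<in> V" "g u \<le> c" "c \<le> g v"
  shows "\<exists>y\<in>V. g y = c"
proof -
  have "(u, v) \<in> (E \<inter> V \<times> V)\<^sup>*"
    using assms by (auto simp: conn_def)
  then have "c \<le> g v \<longrightarrow> (\<exists>y\<in>V. g y = c)"
  proof (induction rule: rtrancl_induct)
    case base
    then show ?case using assms(3,5) by force
  next
    case (step y z)
    then show ?case
      using assms(1)[of y z] by (cases "c = g z") auto
  qed
  then show ?thesis using assms(6) by simp
qed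

lemma adj_rel_induced: "adj_rel (induced G B) = adj_rel G \<inter> B \<times> B"
  by (auto simp: adj_rel_def induced_def)

lemma sym_adj_rel: "sym (adj_rel G)"
  by (auto simp: sym_def adj_rel_def insert_commute)

lemma connected_induced_iff:
  "B \<subseteq> verts G \<Longrightarrow> connected_graph (induced G B) \<longleftrightarrow> conn (adj_rel G) B"
  unfolding connected_graph_def conn_def adj_rel_induced
  by (auto simp: induced_def Int_absorb1)

text \<open>Merging each \<open>R i\<close> with \<open>S i\<close> turns a complete bipartite model
  into a model of the complete graph on \<open>N\<close> vertices, which contains \<open>H\<close>.
  The sets \<open>S k\<close> are disjoint because \<open>g\<close> maps them into disjoint windows
  around multiples of \<open>\<Delta>\<close>.\<close>

lemma minor_of_bipartite_model:
  fixes g :: "'a \<Rightarrow> int"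
  assumes "bipartite_model (adj_rel G) l g \<Delta> N \<rho> (verts G) N S w R" "\<Delta> > 2 * \<rho>"
    and "simple_graph G" "simple_graph H" "card (verts H) \<le> N"
  shows "minor H G"
proof -
  let ?E = "adj_rel G"
  note S = bipartite_modelD(1,2,4)[OF assms(1)] and R = bipartite_modelD(5,6)[OF assms(1)]
    and RR = bipartite_modelD(7)[OF assms(1)] and RS = bipartite_modelD(8,9)[OF assms(1)]
  have SS: "S i \<inter> S j = {}" if "i < N" "j < N" "i \<noteq> j" for i j
  proof -
    have *: "S i \<inter> S j = {}" if "i < j" "j < N" for i j
    proof -
      have False if y: "y \<in> S i" "y \<in> S j" for y
      proof -
        have "\<bar>g y - int i * \<Delta>\<bar> \<le> \<rho>" "\<bar>g y - int j * \<Delta>\<bar> \<le> \<rho>"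
          using S(3)[OF less_trans[OF \<open>i < j\<close> \<open>j < N\<close>] y(1)] S(3)[OF \<open>j < N\<close> y(2)] by simp_all
        then have "\<rho> \<ge> 0" "int j * \<Delta> - int i * \<Delta> \<le> 2 * \<rho>" by linarith+
        moreover have "1 * \<Delta> \<le> (int j - int i) * \<Delta>"
          by (rule mult_right_mono) (use \<open>i < j\<close> assms(2) \<open>\<rho> \<ge> 0\<close> in simp_all)
        ultimately show False
          using assms(2) by (simp only: left_diff_distrib)
      qed
      then show ?thesis by blast
    qed
    show ?thesis
    proof (cases "i < j")
      case True
      then show ?thesis using * that(2) by blast
    next
      case False
      then have "j < i" using that(3) by simp
      then show ?thesis using *[of j i] that(1) by (simp only: Int_commute)
    qed
  qed
  obtain f where f: "bij_betw f (verts H) {0..<card (verts H)}"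
    using ex_bij_betw_finite_nat[of "verts H"] assms(4) by (auto simp: simple_graph_def)
  have fN: "f x < N" if "x \<in> verts H" for x
    using bij_betw_apply[OF f that] assms(5) by simp
  have finj: "f x \<noteq> f y" if "x \<in> verts H" "y \<in> verts H" "x \<noteq> y" for x y
    using inj_on_contraD[OF bij_betw_imp_inj_on[OF f]] that by blast
  define B where "B x = R (f x) \<union> S (f x)" for x
  have "B x \<subseteq> verts G \<and> connected_graph (induced G (B x))" if x: "x \<in> verts H" for x
  proof -
    have sub: "B x \<subseteq> verts G"
      unfolding B_def using S(1)[OF fN[OF x]] R(1)[OF fN[OF x]] by simp
    obtain a b where "a \<in> R (f x)" "b \<in> S (f x)" "(a, b) \<in> ?E"
      using RS(2)[OF fN[OF x] fN[OF x]] by blast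
    then have "conn ?E (B x)"
      unfolding B_def by (rule conn_Un[OF sym_adj_rel R(2)[OF fN[OF x]] S(2)[OF fN[OF x]]])
    then show ?thesis
      unfolding connected_induced_iff[OF sub] using sub by (rule conjI[rotated])
  qed
  moreover have "B x \<inter> B y = {}" if xy: "x \<in> verts H" "y \<in> verts H" "x \<noteq> y" for x y
  proof -
    have "R (f x) \<inter> R (f y) = {}" "S (f x) \<inter> S (f y) = {}"
      "R (f x) \<inter> S (f y) = {}" "R (f y) \<inter> S (f x) = {}"
      using RR SS RS(1) fN[OF xy(1)] fN[OF xy(2)] finj[OF xy] by simp_all
    then show ?thesis
      unfolding B_def by blast
  qed
  moreover have "\<exists>u\<in>B x. \<exists>v\<in>B y. {u, v} \<in> edges G" if "{x, y} \<in> edges H" for x y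
  proof -
    have "x \<in> verts H" "y \<in> verts H"
      using assms(4) that unfolding simple_graph_def by auto
    then obtain a b where "a \<in> R (f x)" "b \<in> S (f y)" "(a, b) \<in> ?E"
      using RS(2)[OF fN fN] by blast
    then show ?thesis
      unfolding B_def adj_rel_def by blast
  qed
  ultimately show ?thesis
    unfolding minor_def using assms(3,4) by (intro conjI exI[of _ B] ballI allI impI) simp_all
qed

text \<open>In the application \<open>g\<close> is the distance in \<open>G\<close> from
  \<open>x\<close>. If it were too large at \<open>y\<close>, intermediate values would give
  \<open>s\<close> vertices of \<open>V\<close> spaced by \<open>\<Delta>\<close>, and the chain
  would expand these into a model that yields \<open>H\<close> as a minor.\<close>

lemma band_chain_weak_diameter:
  fixes g :: "'a \<Rightarrow> int"
  assumes "simple_graph G" "simple_graph H" "\<not> minor H G" "card (verts H) \<le> s" "s \<ge> 2" "l > 0"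
    and chain: "band_chain (adj_rel G) l (verts G) s V" and V: "conn (adj_rel G) V"
    and g: "\<And>u v. (u, v) \<in> adj_rel G \<Longrightarrow> \<bar>g u - g v\<bar> \<le> 1"
    and "x \<in> V" "y \<in> V" "g x = 0"
  shows "g y \<le> int (s * (6 * l * Suc s + 1))"
proof (rule ccontr)
  assume far: "\<not> ?thesis"
  \<comment> \<open>The least integer above \<open>6 * l * Suc s\<close>, as
    \<open>band_chain_model\<close> demands for \<open>\<rho> = 0\<close> and
    \<open>n = s\<close>.\<close>
  define \<Delta> where "\<Delta> = int (6 * l * Suc s + 1)"
  have "\<exists>z\<in>V. g z = int k * \<Delta>" if "k < s" for k
  proof (rule conn_intermediate_value[OF g V \<open>x \<in> V\<close> \<open>y \<in> V\<close>])
    show "g x \<le> int k * \<Delta>" using \<open>g x = 0\<close> by (simp add: \<Delta>_def)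
    have "int k * \<Delta> \<le> int s * \<Delta>" using that by (intro mult_right_mono) (auto simp: \<Delta>_def)
    moreover have "int (s * (6 * l * Suc s + 1)) = int s * \<Delta>" unfolding \<Delta>_def by (simp add: algebra_simps)
    ultimately show "int k * \<Delta> \<le> g y" using far by linarith
  qed auto
  then obtain u where u: "\<And>k. k < s \<Longrightarrow> u k \<in> V \<and> g (u k) = int k * \<Delta>"
    by metis
  \<comment> \<open>The seed consists of singletons without slack; as \<open>m = 0\<close>, all
    clauses about \<open>R\<close> are vacuous.\<close>
  then have "bipartite_model (adj_rel G) l g \<Delta> s 0 V 0 (\<lambda>k. {u k}) u (\<lambda>_. {})"
    by (simp add: bipartite_model_def conn_singleton)
  moreover have "\<Delta> > 2 * 0 + 6 * int l * int (Suc s)"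
    by (simp add: \<Delta>_def algebra_simps)
  ultimately obtain S w R where
    "bipartite_model (adj_rel G) l g \<Delta> s (0 + 3 * int l * int s) (verts G) (0 + s) S w R"
    using band_chain_model[where g = g, OF chain sym_adj_rel g \<open>l > 0\<close> \<open>s \<ge> 2\<close>] by blast
  then have "bipartite_model (adj_rel G) l g \<Delta> s (3 * int l * int s) (verts G) s S w R"
    by simp
  moreover have "\<Delta> > 2 * (3 * int l * int s)"
    by (simp add: \<Delta>_def algebra_simps)
  ultimately have "minor H G"
    by (rule minor_of_bipartite_model[OF _ _ assms(1,2,4)])
  then show False using assms(3) by simp
qed

section \<open>Band colourings\<close>

text \<open>Dropping the last step of a shortest walk yields the parent. This serves both the layers
  inside a component and the distances in the whole graph.\<close>

lemma bfs_Least_relpow: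
  fixes F :: "('a \<times> 'a) set"
  assumes "sym F"
  shows "bfs F {v. (x, v) \<in> F\<^sup>*} x (\<lambda>v. LEAST n. (x, v) \<in> F ^^ n)"
proof -
  define W where "W = {v. (x, v) \<in> F\<^sup>*}"
  define d where "d v = (LEAST n. (x, v) \<in> F ^^ n)" for v
  have walk: "(x, v) \<in> F ^^ d v" if v: "v \<in> W" for v
  proof -
    have "\<exists>n. (x, v) \<in> F ^^ n"
      using v rtrancl_imp_relpow unfolding W_def by blast
    then show ?thesis
      unfolding d_def by (rule LeastI_ex)
  qed
  have d_le: "d v \<le> n" if "(x, v) \<in> F ^^ n" for v n
    unfolding d_def using that by (rule Least_le)
  have Lip: "d v \<le> Suc (d u)" if "u \<in> W" "(u, v) \<in> F" for u v
    by (rule d_le, rule relpow_Suc_I[OF walk[OF that(1)] that(2)])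
  have zero: "d v = 0 \<longleftrightarrow> v = x" if "v \<in> W" for v
    using walk[OF that] d_le[of x 0] by fastforce
  have desc: "\<exists>u\<in>W. (v, u) \<in> F \<and> Suc (d u) = d v" if v: "v \<in> W" "d v > 0" for v
  proof -
    obtain k where k: "d v = Suc k" using v(2) gr0_conv_Suc by blast
    then obtain u where u: "(x, u) \<in> F ^^ k" "(u, v) \<in> F"
      using walk[OF v(1)] relpow_Suc_E by metis
    have "u \<in> W" using relpow_imp_rtrancl[OF u(1)] by (simp add: W_def)
    moreover have "Suc (d u) = d v"
      using d_le[OF u(1)] Lip[OF \<open>u \<in> W\<close> u(2)] k by simp
    ultimately show ?thesis using symD[OF assms u(2)] by blast
  qed
  have "x \<in> W" by (simp add: W_def)
  then have "bfs F W x d"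
    unfolding bfs_def using Lip zero desc by simp
  then show ?thesis
    by (simp add: W_def d_def[abs_def])
qed

section \<open>Monochromatic components and their layers\<close>

definition mono_rel :: "('a \<times> 'a) set \<Rightarrow> ('a \<Rightarrow> 'c) \<Rightarrow> ('a \<times> 'a) set" where
  "mono_rel E c = {(u, v) \<in> E. c u = c v}"

definition mono_comp :: "('a \<times> 'a) set \<Rightarrow> ('a \<Rightarrow> 'c) \<Rightarrow> 'a \<Rightarrow> 'a set" where
  "mono_comp E c v = {u. (v, u) \<in> (mono_rel E c)\<^sup>*}"

lemma sym_mono_rel: "sym E \<Longrightarrow> sym (mono_rel E c)"
  by (auto simp: sym_def mono_rel_def)

lemma mono_comp_refl: "v \<in> mono_comp E c v"
  by (simp add: mono_comp_def)

lemma mono_comp_step: "u \<in> mono_comp E c v \<Longrightarrow> (u, w) \<in> E \<Longrightarrow> c u = c w \<Longrightarrow> w \<in> mono_comp E c v"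
  unfolding mono_comp_def mono_rel_def by (auto intro: rtrancl.rtrancl_into_rtrancl)

lemma mono_comp_colour:
  assumes "u \<in> mono_comp E c v"
  shows "c u = c v"
proof -
  have "(v, u) \<in> (mono_rel E c)\<^sup>*"
    using assms by (simp add: mono_comp_def)
  then show ?thesis
    by induction (auto simp: mono_rel_def)
qed

lemma mono_comp_sym: "sym E \<Longrightarrow> u \<in> mono_comp E c v \<Longrightarrow> v \<in> mono_comp E c u"
  unfolding mono_comp_def using sym_rtrancl[OF sym_mono_rel] symD by fastforce

lemma mono_comp_trans: "u \<in> mono_comp E c v \<Longrightarrow> w \<in> mono_comp E c u \<Longrightarrow> w \<in> mono_comp E c v"
  unfolding mono_comp_def using rtrancl_trans by fast

lemma mono_comp_eq: "sym E \<Longrightarrow> u \<in> mono_comp E c v \<Longrightarrow> mono_comp E c u = mono_comp E c v"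
  using mono_comp_sym mono_comp_trans by (metis subsetI subset_antisym)

lemma conn_mono_comp:
  assumes "sym E"
  shows "conn E (mono_comp E c v)"
proof (rule connI_center[OF assms])
  show "v \<in> mono_comp E c v" by (rule mono_comp_refl)
  let ?F = "E \<inter> mono_comp E c v \<times> mono_comp E c v"
  fix u assume "u \<in> mono_comp E c v"
  then have "(v, u) \<in> (mono_rel E c)\<^sup>*"
    by (simp add: mono_comp_def)
  then have "(v, u) \<in> ?F\<^sup>*"
  proof induction
    case (step y z)
    then have "(y, z) \<in> ?F"
      by (auto simp: mono_comp_def mono_rel_def intro: rtrancl.rtrancl_into_rtrancl)
    then show ?case
      using step.IH by (rule rtrancl.rtrancl_into_rtrancl[rotated])
  qed simp
  moreover have "sym ?F"
    using assms by (auto simp: sym_def)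
  ultimately show "(u, v) \<in> ?F\<^sup>*"
    using sym_rtrancl symD by metis
qed

text \<open>Taking the least vertex makes the root depend on the component alone, so all vertices of
  a component share one layering.\<close>

definition comp_root :: "(nat \<times> nat) set \<Rightarrow> (nat \<Rightarrow> 'c) \<Rightarrow> nat \<Rightarrow> nat" where
  "comp_root E c v = (LEAST u. u \<in> mono_comp E c v)"

definition layer :: "(nat \<times> nat) set \<Rightarrow> (nat \<Rightarrow> 'c) \<Rightarrow> nat \<Rightarrow> nat" where
  "layer E c v = (LEAST n. (comp_root E c v, v) \<in> mono_rel E c ^^ n)"

text \<open>Edges of \<open>E\<close> between vertices of one component are monochromatic, so a
  layering for \<open>mono_rel E c\<close> is also one for \<open>E\<close>.\<close>

lemma bfs_layer:
  assumes "sym E"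
  shows "bfs E (mono_comp E c v) (comp_root E c v) (layer E c)"
proof -
  let ?x = "comp_root E c v" and ?W = "mono_comp E c v"
  have x: "?x \<in> ?W"
    unfolding comp_root_def using LeastI[of "\<lambda>u. u \<in> ?W", OF mono_comp_refl] .
  have W: "{u. (?x, u) \<in> (mono_rel E c)\<^sup>*} = ?W"
    using mono_comp_eq[OF assms x] unfolding mono_comp_def .
  have *: "bfs (mono_rel E c) ?W ?x (\<lambda>u. LEAST n. (?x, u) \<in> mono_rel E c ^^ n)"
    using bfs_Least_relpow[OF sym_mono_rel[OF assms, of c], of ?x] unfolding W .
  have "comp_root E c u = ?x" if "u \<in> ?W" for u
    unfolding comp_root_def mono_comp_eq[OF assms that] ..
  then have lay: "layer E c u = (LEAST n. (?x, u) \<in> mono_rel E c ^^ n)" if "u \<in> ?W" for u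
    unfolding layer_def using that by simp
  have E: "(u, w) \<in> mono_rel E c \<longleftrightarrow> (u, w) \<in> E" if "u \<in> ?W" "w \<in> ?W" for u w
    using mono_comp_colour[OF that(1)] mono_comp_colour[OF that(2)] by (simp add: mono_rel_def)
  show ?thesis
    using * unfolding bfs_def by (simp add: lay E cong: ball_cong bex_cong)
qed

text \<open>The index \<open>q\<close>, read in base \<open>l\<close>, lists the offsets of the bands in the successive
  rounds. Adjacent vertices of the same component lie in equal or consecutive bands, so the parity
  of the band tells neighbouring bands apart.\<close>
fun band_colour :: "(nat \<times> nat) set \<Rightarrow> nat \<Rightarrow> nat \<Rightarrow> nat \<Rightarrow> nat \<Rightarrow> bool list" where
  "band_colour E l 0 q v = []"
| "band_colour E l (Suc n) q v =
     odd ((layer E (band_colour E l n (q div l)) v + q mod l) div l) # band_colour E l n (q div l) v"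

lemma length_band_colour: "length (band_colour E l n q v) = n"
  by (induction n arbitrary: q) auto

lemma div_Lipschitz:
  fixes a b l :: nat
  assumes "a \<le> Suc b" "l > 0"
  shows "a div l \<le> Suc (b div l)"
proof -
  have "a div l \<le> (b + l) div l"
    by (rule div_le_mono) (use assms in simp)
  then show ?thesis using assms(2) by simp
qed

text \<open>With zero rounds all colours agree and the component is \<open>V\<close>. Each further
  bit confines a component to a single band of the layering from the round before.\<close>

lemma band_chain_band_colour:
  assumes "sym E" "l > 0" "mono_comp E (band_colour E l 0 0) v = V"
  shows "band_chain E l V n (mono_comp E (band_colour E l n q) v)"
proof (induction n arbitrary: q)
  case 0
  have "mono_comp E (band_colour E l 0 q) v = V"
    using assms(3) by (simp add: mono_comp_def mono_rel_def)
  then show ?case by (simp only: band_chain.base)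
next
  case (Suc n)
  let ?c = "band_colour E l n (q div l)" and ?c' = "band_colour E l (Suc n) q"
  let ?W = "mono_comp E ?c v" and ?V = "mono_comp E ?c' v"
  define d where "d = layer E ?c"
  define b where "b u = (d u + q mod l) div l" for u
  \<comment> \<open>The subtraction can truncate only if \<open>b v = 0\<close>; that first band may
    have fewer than \<open>l\<close> layers, and \<open>0\<close> is then its correct lowest
    layer.\<close>
  define lo where "lo = b v * l - q mod l"
  have bfs: "bfs E ?W (comp_root E ?c v) d"
    unfolding d_def by (rule bfs_layer[OF assms(1)])
  have Lip: "d w \<le> Suc (d u)" if "u \<in> ?W" "w \<in> ?W" "(u, w) \<in> E" for u w
    using bfs that unfolding bfs_def by blast
  have c': "?c' u = odd (b u) # ?c u" for u
    by (simp add: b_def d_def)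
  have VW: "?V \<subseteq> ?W"
  proof
    fix u assume "u \<in> ?V"
    moreover have "mono_rel E ?c' \<subseteq> mono_rel E ?c"
      by (auto simp: mono_rel_def)
    ultimately show "u \<in> ?W"
      unfolding mono_comp_def using rtrancl_mono by blast
  qed
  \<comment> \<open>Along an edge the band number changes by at most one, and equal colours force
    equal parity, so it does not change at all.\<close>
  have bV: "b u = b v" if "u \<in> ?V" for u
  proof -
    have "(v, u) \<in> (mono_rel E ?c')\<^sup>*"
      using that by (simp add: mono_comp_def)
    then show ?thesis
    proof induction
      case (step y z)
      have yz: "(y, z) \<in> E" "?c' y = ?c' z"
        using step.hyps(2) by (simp_all add: mono_rel_def)
      have y: "y \<in> ?V"
        using step.hyps(1) by (simp add: mono_comp_def)
      have z: "z \<in> ?V"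
        using mono_comp_step[OF y yz] .
      have "d z \<le> Suc (d y)" "d y \<le> Suc (d z)"
        using Lip[OF subsetD[OF VW y] subsetD[OF VW z] yz(1)]
          Lip[OF subsetD[OF VW z] subsetD[OF VW y] symD[OF assms(1) yz(1)]] by auto
      then have "b z \<le> Suc (b y)" "b y \<le> Suc (b z)"
        unfolding b_def by (auto intro!: div_Lipschitz assms(2))
      moreover have "odd (b y) = odd (b z)"
        using yz(2) unfolding c' by simp
      ultimately have "b y = b z"
        by presburger
      then show ?case using step.IH by simp
    qed simp
  qed
  have o: "q mod l < l" using assms(2) by simp
  have bound: "b u * l \<le> d u + q mod l" "d u + q mod l < b u * l + l" for u
    using assms(2) div_times_less_eq_dividend[of "d u + q mod l" l] dividend_less_div_times[of l "d u + q mod l"]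
    by (simp_all add: b_def algebra_simps)
  have "band E l ?W d lo ?V"
    unfolding band_def
  proof (intro conjI ballI impI)
    show "?V \<subseteq> ?W" by (rule VW)
    fix u assume u: "u \<in> ?V"
    show "lo \<le> d u" "d u < lo + l"
      using bound[of u] bV[OF u] unfolding lo_def by auto
    fix w assume w: "w \<in> ?W" "(u, w) \<in> E" "lo \<le> d w" "d w \<le> d u"
    have "b w \<le> b u"
      unfolding b_def using w(4) by (intro div_le_mono) simp
    moreover have "b v * l \<le> d w + q mod l"
      using w(3) unfolding lo_def by simp
    then have "b v \<le> b w"
      unfolding b_def[of w] using assms(2) by (simp add: less_eq_div_iff_mult_less_eq)
    ultimately have "b w = b u"
      using bV[OF u] by simp
    moreover have "?c w = ?c u"
      using mono_comp_colour[OF w(1)] mono_comp_colour[OF subsetD[OF VW u]] by simp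
    ultimately have "?c' u = ?c' w"
      unfolding c' by simp
    then show "w \<in> ?V"
      by (rule mono_comp_step[OF u w(2)])
  qed
  then show ?case
    by (rule band_chain.step[OF Suc.IH bfs])
qed

section \<open>Counting the offsets that separate an edge\<close>

lemma card_div_mod_decompose:
  fixes l m :: nat
  assumes "l > 0"
  shows "card {q. q < l * m \<and> P (q div l) (q mod l)} = (\<Sum>a<m. card {b. b < l \<and> P a b})"
proof -
  have "bij_betw (\<lambda>q. (q div l, q mod l)) {q. q < l * m \<and> P (q div l) (q mod l)}
      (SIGMA a:{..<m}. {b. b < l \<and> P a b})"
  proof (rule bij_betw_byWitness[where f' = "\<lambda>(a, b). a * l + b"])
    show "(\<lambda>q. (q div l, q mod l)) ` {q. q < l * m \<and> P (q div l) (q mod l)} \<subseteq>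
        (SIGMA a:{..<m}. {b. b < l \<and> P a b})"
      using assms by (auto simp: less_mult_imp_div_less mult.commute)
    have "a * l + b < l * m" if "a < m" "b < l" for a b
    proof -
      have "a * l + b < Suc a * l" using that by simp
      also have "\<dots> \<le> m * l" using that by (intro mult_le_mono1) simp
      finally show ?thesis by (simp add: mult.commute)
    qed
    then show "(\<lambda>(a, b). a * l + b) ` (SIGMA a:{..<m}. {b. b < l \<and> P a b}) \<subseteq>
        {q. q < l * m \<and> P (q div l) (q mod l)}"
      by auto
  qed auto
  then have "card {q. q < l * m \<and> P (q div l) (q mod l)} = card (SIGMA a:{..<m}. {b. b < l \<and> P a b})"
    by (rule bij_betw_same_card)
  then show ?thesis
    by (simp add: card_SigmaI)
qed

text \<open>If \<open>a = Suc b\<close>, the quotients differ only when \<open>l\<close> divides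
  \<open>Suc (b + r)\<close>, which happens for at most one of \<open>l\<close> consecutive values
  of \<open>r\<close>.\<close>

lemma card_separating_offsets:
  fixes a b l :: nat
  assumes "a \<le> Suc b" "b \<le> Suc a" "l > 0"
  shows "card {r. r < l \<and> odd ((a + r) div l) \<noteq> odd ((b + r) div l)} \<le> 1"
proof -
  have *: "card {r. r < l \<and> odd ((Suc b + r) div l) \<noteq> odd ((b + r) div l)} \<le> 1" (is "card ?R \<le> 1") for b
  proof -
    have dvd: "l dvd Suc (b + r)" if r: "r \<in> ?R" for r
    proof -
      have "odd ((Suc b + r) div l) \<noteq> odd ((b + r) div l)"
        using r by blast
      then have "Suc (b + r) div l \<noteq> (b + r) div l"
        unfolding add_Suc by metis
      then have "Suc (b + r) mod l = 0"
        using div_Suc[of "b + r" l] by metis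
      then show ?thesis by (rule mod_0_imp_dvd)
    qed
    have *: "r = r'" if r: "r \<in> ?R" "r' \<in> ?R" "r \<le> r'" for r r'
    proof -
      have "l dvd Suc (b + r') - Suc (b + r)"
        by (rule dvd_diff_nat[OF dvd dvd]) fact+
      then have "l dvd r' - r" by simp
      moreover have "r' < l" using r(2) by blast
      then have "r' - r < l" by simp
      ultimately show ?thesis
        using r(3) nat_dvd_not_less[of "r' - r" l] by (cases "r' = r") simp_all
    qed
    have "r = r'" if r: "r \<in> ?R" "r' \<in> ?R" for r r'
    proof (cases "r \<le> r'")
      case True
      then show ?thesis by (rule *[OF r])
    next
      case False
      then have "r' \<le> r" by simp
      then show ?thesis by (rule *[OF r(2,1), symmetric])
    qed
    moreover have "finite ?R"
      by (rule finite_subset[OF _ finite_lessThan[of l]]) blast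
    ultimately show ?thesis
      unfolding One_nat_def by (subst card_le_Suc0_iff_eq) blast+
  qed
  consider "a = b" | "a = Suc b" | "b = Suc a"
    using assms by linarith
  then show ?thesis
  proof cases
    case 1
    then show ?thesis by simp
  next
    case 2
    then show ?thesis using *[of b] by (simp only:)
  next
    case 3
    have "{r. r < l \<and> odd ((a + r) div l) \<noteq> odd ((b + r) div l)} =
        {r. r < l \<and> odd ((Suc a + r) div l) \<noteq> odd ((a + r) div l)}"
      unfolding 3 by blast
    then show ?thesis using *[of a] by (simp only:)
  qed
qed

text \<open>A union bound over the rounds, each contributing a fraction of at most
  \<open>1 / l\<close>, multiplied out to stay in the naturals. The offset of the last round is the
  lowest base \<open>l\<close> digit of \<open>q\<close>.\<close>

lemma card_separating_band_colours:
  assumes "sym E" "l > 0" "(u, v) \<in> E"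
  shows "card {q. q < l ^ n \<and> band_colour E l n q u \<noteq> band_colour E l n q v} * l \<le> n * l ^ n"
proof (induction n)
  case (Suc n)
  define C where "C a = band_colour E l n a" for a
  define A where "A = {a. a < l ^ n \<and> C a u \<noteq> C a v}"
  define P where "P a b \<longleftrightarrow> odd ((layer E (C a) u + b) div l) \<noteq> odd ((layer E (C a) v + b) div l) \<or>
      C a u \<noteq> C a v" for a b
  \<comment> \<open>For \<open>a\<close> in \<open>A\<close> the edge is already cut and all
    \<open>l\<close> offsets are given up. Otherwise its ends share a component, their layers differ
    by at most one, and at most one offset separates them.\<close>
  have P: "card {b. b < l \<and> P a b} \<le> (if a \<in> A then l else 1)" if a: "a < l ^ n" for a
  proof (cases "a \<in> A")
    case True
    have "card {b. b < l \<and> P a b} \<le> card {..<l}"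
      by (rule card_mono) auto
    then show ?thesis using True by simp
  next
    case False
    then have eq: "C a u = C a v" using a by (simp add: A_def)
    have uv: "u \<in> mono_comp E (C a) u" "v \<in> mono_comp E (C a) u"
      using mono_comp_refl mono_comp_step[OF mono_comp_refl assms(3) eq] by auto
    have "layer E (C a) v \<le> Suc (layer E (C a) u)" "layer E (C a) u \<le> Suc (layer E (C a) v)"
      using bfs_layer[OF assms(1), of "C a" u] uv assms(3) symD[OF assms(1,3)]
      unfolding bfs_def by blast+
    then show ?thesis
      using card_separating_offsets[OF _ _ assms(2)] False eq by (simp add: P_def)
  qed
  have "card {q. q < l ^ Suc n \<and> band_colour E l (Suc n) q u \<noteq> band_colour E l (Suc n) q v} =
      card {q. q < l * l ^ n \<and> P (q div l) (q mod l)}"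
    by (simp add: P_def C_def)
  also have "\<dots> = (\<Sum>a<l ^ n. card {b. b < l \<and> P a b})"
    by (rule card_div_mod_decompose[OF assms(2)])
  also have "\<dots> \<le> (\<Sum>a<l ^ n. (if a \<in> A then l else 0) + 1)"
    by (rule sum_mono) (use P in \<open>force split: if_splits\<close>)
  also have "\<dots> = card A * l + l ^ n"
  proof -
    have "{..<l ^ n} \<inter> {a. a \<in> A} = A" by (auto simp: A_def)
    then show ?thesis
      unfolding sum.distrib by (simp add: sum.If_cases)
  qed
  finally have "card {q. q < l ^ Suc n \<and> band_colour E l (Suc n) q u \<noteq> band_colour E l (Suc n) q v} * l
      \<le> (card A * l + l ^ n) * l"
    by (rule mult_le_mono1)
  also have "\<dots> \<le> (n * l ^ n + l ^ n) * l"
    using Suc.IH unfolding A_def C_def by (intro mult_le_mono1 add_le_mono1)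
  finally show ?case
    by (simp add: algebra_simps)
qed simp

section \<open>Balls and monochromatic components\<close>

lemma relpow_mono:
  fixes F F' :: "('a \<times> 'a) set"
  assumes "F \<subseteq> F'"
  shows "F ^^ n \<subseteq> F' ^^ n"
  by (induction n) (use assms in auto)

text \<open>An infimum of naturals in \<open>enat\<close> is attained unless the set is empty, when
  it is \<open>\<infinity>\<close>; so balls can be handled through walks.\<close>

lemma gball_iff: "u \<in> gball G v r \<longleftrightarrow> u \<in> verts G \<and> (\<exists>n\<le>r. (v, u) \<in> adj_rel G ^^ n)"
proof -
  let ?S = "{n. (v, u) \<in> adj_rel G ^^ n}"
  have "gdist G v u \<le> enat r \<longleftrightarrow> (\<exists>n\<in>?S. n \<le> r)"
  proof
    assume le: "gdist G v u \<le> enat r"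
    have "?S \<noteq> {}"
    proof
      assume "?S = {}"
      then have "gdist G v u = \<infinity>"
        unfolding gdist_def by (simp only: image_empty) (simp add: top_enat_def)
      then show False using le by simp
    qed
    then have "gdist G v u \<in> enat ` ?S"
      unfolding gdist_def Inf_enat_def by (auto intro: LeastI)
    then obtain n where n: "n \<in> ?S" "gdist G v u = enat n"
      by blast
    then show "\<exists>n\<in>?S. n \<le> r"
      using le by auto
  next
    assume "\<exists>n\<in>?S. n \<le> r"
    then obtain n where n: "n \<in> ?S" "n \<le> r" by blast
    have "gdist G v u \<le> enat n"
      unfolding gdist_def using n(1) by (rule INF_lower)
    also have "enat n \<le> enat r" using n(2) by simp
    finally show "gdist G v u \<le> enat r" .
  qed
  then show ?thesis
    by (auto simp: gball_def)
qed

lemma gballI: "u \<in> verts G \<Longrightarrow> n \<le> r \<Longrightarrow> (v, u) \<in> adj_rel G ^^ n \<Longrightarrow> u \<in> gball G v r"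
  unfolding gball_iff by (intro conjI exI[of _ n])

lemma gballE:
  assumes "u \<in> gball G v r"
  obtains n where "u \<in> verts G" "n \<le> r" "(v, u) \<in> adj_rel G ^^ n"
  using assms unfolding gball_iff by (elim conjE exE)

lemma adj_rel_verts: "simple_graph G \<Longrightarrow> (u, v) \<in> adj_rel G \<Longrightarrow> u \<in> verts G \<and> v \<in> verts G"
  unfolding simple_graph_def adj_rel_def by auto

lemma edge_pair:
  assumes "simple_graph G" "e \<in> edges G"
  obtains a b where "e = {a, b}"
proof -
  have "card e = 2" using assms unfolding simple_graph_def by blast
  then show thesis using that by (auto simp: card_2_iff)
qed

lemma gball_refl: "v \<in> verts G \<Longrightarrow> v \<in> gball G v r"
  by (rule gballI[of _ _ 0]) simp_all

lemma gball_step: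
  assumes "simple_graph G" "u \<in> gball G v r" "(u, w) \<in> adj_rel G"
  shows "w \<in> gball G v (Suc r)"
proof -
  obtain n where n: "n \<le> r" "(v, u) \<in> adj_rel G ^^ n"
    using assms(2) by (rule gballE)
  show ?thesis
  proof (rule gballI)
    show "w \<in> verts G" using adj_rel_verts[OF assms(1,3)] ..
    show "Suc n \<le> Suc r" using n(1) by simp
    show "(v, w) \<in> adj_rel G ^^ Suc n" using n(2) assms(3) by (rule relpow_Suc_I)
  qed
qed

lemma gball_mono: "r \<le> r' \<Longrightarrow> gball G v r \<subseteq> gball G v r'"
  by (rule subsetI, erule gballE, rule gballI, assumption, rule order_trans)

lemma gball_induced_subset: "gball (induced G X) v r \<subseteq> gball G v r"
proof
  fix u assume "u \<in> gball (induced G X) v r"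
  then obtain n where n: "u \<in> verts (induced G X)" "n \<le> r" "(v, u) \<in> adj_rel (induced G X) ^^ n"
    by (rule gballE)
  have "adj_rel (induced G X) \<subseteq> adj_rel G"
    unfolding adj_rel_induced by (rule Int_lower1)
  then have "(v, u) \<in> adj_rel G ^^ n"
    using n(3) by (rule subsetD[OF relpow_mono])
  moreover have "u \<in> verts G"
    using n(1) by (simp add: induced_def)
  ultimately show "u \<in> gball G v r"
    using n(2) by (intro gballI)
qed

text \<open>Every prefix of a walk of length at most \<open>r\<close> from \<open>v\<close> ends in
  the ball, so short distances from the centre survive the restriction.\<close>

lemma gball_induced_gball:
  assumes "simple_graph G" "v \<in> verts G" "k \<le> r"
  shows "gball (induced G (gball G v r)) v k = gball G v k"
proof
  define B where "B = gball G v r"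
  have walk: "(v, u) \<in> adj_rel (induced G B) ^^ n" if "(v, u) \<in> adj_rel G ^^ n" "n \<le> r" for u n
    using that
  proof (induction n arbitrary: u)
    case (Suc n)
    obtain y where y: "(v, y) \<in> adj_rel G ^^ n" "(y, u) \<in> adj_rel G"
      using Suc.prems(1) by (rule relpow_Suc_E)
    have n: "n \<le> r" using Suc.prems(2) by simp
    have "y \<in> B" "u \<in> B"
      using gballI[OF _ n y(1)] gballI[OF _ Suc.prems(2,1)] adj_rel_verts[OF assms(1) y(2)]
      by (simp_all add: B_def)
    then have "(y, u) \<in> adj_rel (induced G B)"
      using y(2) by (simp add: adj_rel_induced)
    then show ?case
      by (rule relpow_Suc_I[OF Suc.IH[OF y(1) n]])
  qed simp
  have "gball G v k \<subseteq> gball (induced G B) v k"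
  proof
    fix u assume u: "u \<in> gball G v k"
    then obtain n where n: "u \<in> verts G" "n \<le> k" "(v, u) \<in> adj_rel G ^^ n"
      by (rule gballE)
    have "u \<in> B"
      using u gball_mono[OF assms(3)] unfolding B_def by (rule subsetD[rotated])
    then have "u \<in> verts (induced G B)"
      using n(1) by (simp add: induced_def)
    then show "u \<in> gball (induced G B) v k"
      using n(2) walk[OF n(3)] assms(3) by (intro gballI) simp_all
  qed
  then show "gball G v k \<subseteq> gball (induced G (gball G v r)) v k"
    by (simp only: B_def)
qed (rule gball_induced_subset)

lemma induced_induced: "induced (induced G X) Y = induced G (X \<inter> Y)"
  by (auto simp: induced_def)

lemma simple_graph_induced: "simple_graph G \<Longrightarrow> simple_graph (induced G X)"
  by (auto simp: simple_graph_def induced_def)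

lemma subgraph_induced: "simple_graph G \<Longrightarrow> subgraph (induced G X) G"
  unfolding subgraph_def using simple_graph_induced by (auto simp: induced_def)

section \<open>Monochromatic components in induced subgraphs\<close>

lemma mono_comp_subset_verts:
  assumes "simple_graph G" "v \<in> verts G"
  shows "mono_comp (adj_rel G) c v \<subseteq> verts G"
proof
  fix u assume "u \<in> mono_comp (adj_rel G) c v"
  then have "(v, u) \<in> (mono_rel (adj_rel G) c)\<^sup>*"
    by (simp add: mono_comp_def)
  then show "u \<in> verts G"
    by induction (use assms in \<open>auto simp: mono_rel_def dest: adj_rel_verts\<close>)
qed

lemma mono_rel_induced: "mono_rel (adj_rel (induced G X)) c = mono_rel (adj_rel G) c \<inter> X \<times> X"
  by (auto simp: mono_rel_def adj_rel_induced)

text \<open>Used when only the component inside \<open>X\<close> is known: if all neighbours of its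
  vertices lie in \<open>X\<close>, nothing can continue it outside. The companion
  \<open>mono_comp_induced_superset\<close> starts from the component in \<open>G\<close>
  instead.\<close>

lemma mono_comp_induced_eq:
  assumes "v \<in> X" and closed: "\<And>u w. u \<in> mono_comp (adj_rel (induced G X)) c v \<Longrightarrow> (u, w) \<in> adj_rel G \<Longrightarrow> w \<in> X"
  shows "mono_comp (adj_rel (induced G X)) c v = mono_comp (adj_rel G) c v"
proof
  have "mono_rel (adj_rel (induced G X)) c \<subseteq> mono_rel (adj_rel G) c"
    by (auto simp: mono_rel_induced)
  then show "mono_comp (adj_rel (induced G X)) c v \<subseteq> mono_comp (adj_rel G) c v"
    unfolding mono_comp_def using rtrancl_mono by blast
  show "mono_comp (adj_rel G) c v \<subseteq> mono_comp (adj_rel (induced G X)) c v"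
  proof
    fix u assume "u \<in> mono_comp (adj_rel G) c v"
    then have "(v, u) \<in> (mono_rel (adj_rel G) c)\<^sup>*"
      by (simp add: mono_comp_def)
    then have "u \<in> X \<and> u \<in> mono_comp (adj_rel (induced G X)) c v"
    proof induction
      case base
      then show ?case using assms(1) by (simp add: mono_comp_refl)
    next
      case (step y z)
      have yz: "(y, z) \<in> adj_rel G" "c y = c z"
        using step.hyps(2) by (simp_all add: mono_rel_def)
      have z: "z \<in> X" using closed[OF conjunct2[OF step.IH] yz(1)] .
      have "(y, z) \<in> adj_rel (induced G X)"
        using yz(1) z step.IH by (simp add: adj_rel_induced)
      then show ?case
        using mono_comp_step[OF conjunct2[OF step.IH] _ yz(2)] z by simp
    qed
    then show "u \<in> mono_comp (adj_rel (induced G X)) c v" by simp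
  qed
qed

lemma mono_comp_induced_superset:
  assumes "v \<in> X" "mono_comp (adj_rel G) c v \<subseteq> X"
  shows "mono_comp (adj_rel (induced G X)) c v = mono_comp (adj_rel G) c v"
proof
  have "mono_rel (adj_rel (induced G X)) c \<subseteq> mono_rel (adj_rel G) c"
    by (auto simp: mono_rel_induced)
  then show "mono_comp (adj_rel (induced G X)) c v \<subseteq> mono_comp (adj_rel G) c v"
    unfolding mono_comp_def using rtrancl_mono by blast
  show "mono_comp (adj_rel G) c v \<subseteq> mono_comp (adj_rel (induced G X)) c v"
  proof
    fix u assume "u \<in> mono_comp (adj_rel G) c v"
    then have "(v, u) \<in> (mono_rel (adj_rel G) c)\<^sup>*"
      by (simp add: mono_comp_def)
    then show "u \<in> mono_comp (adj_rel (induced G X)) c v"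
    proof induction
      case base
      then show ?case by (simp add: mono_comp_refl)
    next
      case (step y z)
      have yz: "(y, z) \<in> adj_rel G" "c y = c z"
        using step.hyps(2) by (simp_all add: mono_rel_def)
      have y: "y \<in> mono_comp (adj_rel G) c v"
        using step.hyps(1) by (simp add: mono_comp_def)
      have "(y, z) \<in> adj_rel (induced G X)"
        using yz(1) y mono_comp_step[OF y yz] assms(2) by (auto simp: adj_rel_induced)
      then show ?case
        by (rule mono_comp_step[OF step.IH _ yz(2)])
    qed
  qed
qed

lemma mono_rel_cong:
  assumes "simple_graph G" "\<And>u. u \<in> verts G \<Longrightarrow> c u = c' u"
  shows "mono_rel (adj_rel G) c = mono_rel (adj_rel G) c'"
  using assms(2) adj_rel_verts[OF assms(1)] by (auto simp: mono_rel_def)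

lemma mono_comp_cong:
  assumes "simple_graph G" "\<And>u. u \<in> verts G \<Longrightarrow> c u = c' u"
  shows "mono_comp (adj_rel G) c v = mono_comp (adj_rel G) c' v"
  unfolding mono_comp_def using mono_rel_cong[OF assms] by simp

section \<open>Deleting the edges between colour classes\<close>

definition mono_graph :: "'a ugraph \<Rightarrow> ('a \<Rightarrow> 'c) \<Rightarrow> 'a ugraph" where
  "mono_graph G c = \<lparr> verts = verts G, edges = {e \<in> edges G. \<forall>u\<in>e. \<forall>v\<in>e. c u = c v} \<rparr>"

lemma edge_subset_mono_comp_iff:
  assumes "simple_graph G" "e \<in> edges G"
  shows "(\<exists>v\<in>verts G. e \<subseteq> mono_comp (adj_rel G) c v) \<longleftrightarrow> (\<forall>u\<in>e. \<forall>v\<in>e. c u = c v)"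
proof
  assume "\<exists>v\<in>verts G. e \<subseteq> mono_comp (adj_rel G) c v"
  then obtain v where v: "e \<subseteq> mono_comp (adj_rel G) c v" by blast
  have "c u = c v" if "u \<in> e" for u
    using mono_comp_colour[OF subsetD[OF v that]] .
  then show "\<forall>u\<in>e. \<forall>v\<in>e. c u = c v" by simp
next
  assume eq: "\<forall>u\<in>e. \<forall>v\<in>e. c u = c v"
  obtain a b where ab: "e = {a, b}"
    using edge_pair[OF assms] .
  then have adj: "(a, b) \<in> adj_rel G"
    using assms(2) by (simp add: adj_rel_def)
  have "c a = c b"
    by (rule eq[rule_format]) (simp_all add: ab)
  then have "e \<subseteq> mono_comp (adj_rel G) c a"
    using mono_comp_step[OF mono_comp_refl adj] by (simp add: ab mono_comp_refl)
  moreover have "a \<in> verts G"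
    using adj_rel_verts[OF assms(1) adj] by (rule conjunct1)
  ultimately show "\<exists>v\<in>verts G. e \<subseteq> mono_comp (adj_rel G) c v"
    by (rule bexI)
qed

text \<open>Components are added one at a time, each disjoint from the union so far. The induction
  starts at a single component, since the empty graph need not be known to lie in
  \<open>\<P>\<close>.\<close>

lemma mono_graph_in_summable:
  fixes G :: lgraph
  assumes "summable_property \<P>" "simple_graph G" "verts G \<noteq> {}"
    and comp: "\<And>v. v \<in> verts G \<Longrightarrow> induced G (mono_comp (adj_rel G) c v) \<in> \<P>"
  shows "mono_graph G c \<in> \<P>"
proof -
  let ?comp = "mono_comp (adj_rel G) c"
  define U where "U A = \<lparr> verts = \<Union> (?comp ` A), edges = {e \<in> edges G. \<exists>v\<in>A. e \<subseteq> ?comp v} \<rparr>" for A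
  have ind: "induced G (?comp v) = U {v}" if "v \<in> verts G" for v
    using mono_comp_subset_verts[OF assms(2) that, of c] by (simp add: induced_def U_def Int_absorb1)
  have disj: "?comp u = ?comp v" if "w \<in> ?comp u" "w \<in> ?comp v" for u v w
    using mono_comp_eq[OF sym_adj_rel that(1)] mono_comp_eq[OF sym_adj_rel that(2)] by simp
  have "finite (verts G)" using assms(2) by (simp add: simple_graph_def)
  have "U A \<in> \<P>" if "finite A" "A \<noteq> {}" "A \<subseteq> verts G" for A
    using that
  proof (induction A rule: finite_ne_induct)
    case (singleton v)
    then show ?case using comp[of v] ind[of v] by simp
  next
    case (insert v A)
    show ?case
    \<comment> \<open>Components are indexed by their vertices, so that of \<open>v\<close> may
      already be present, and then the union stays the same.\<close>
    proof (cases "\<exists>u\<in>A. ?comp u = ?comp v")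
      case True
      then obtain u where u: "u \<in> A" "?comp u = ?comp v" by blast
      have "\<Union> (?comp ` insert v A) = \<Union> (?comp ` A)"
        using u by blast
      moreover have "(\<exists>w\<in>insert v A. e \<subseteq> ?comp w) \<longleftrightarrow> (\<exists>w\<in>A. e \<subseteq> ?comp w)" for e
        using u by blast
      ultimately have "U (insert v A) = U A" unfolding U_def by simp
      then show ?thesis using insert by simp
    next
      case False
      then have "?comp v \<inter> ?comp u = {}" if "u \<in> A" for u
        using disj[of _ u v] that by blast
      then have "verts (U {v}) \<inter> verts (U A) = {}"
        unfolding U_def by auto
      moreover have "U {v} \<in> \<P>" using comp[of v] ind[of v] insert.prems by simp
      moreover have "U A \<in> \<P>" using insert by simp
      ultimately have "graph_union (U {v}) (U A) \<in> \<P>"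
        using assms(1) unfolding summable_property_def by blast
      moreover have "graph_union (U {v}) (U A) = U (insert v A)"
        unfolding graph_union_def U_def by (simp add: Collect_disj_eq[symmetric] conj_disj_distribL)
      ultimately show ?thesis by simp
    qed
  qed
  then have "U (verts G) \<in> \<P>"
    using \<open>finite (verts G)\<close> assms(3) by blast
  moreover have "U (verts G) = mono_graph G c"
  proof -
    have V: "\<Union> (?comp ` verts G) = verts G"
    proof
      show "\<Union> (?comp ` verts G) \<subseteq> verts G"
        by (rule UN_least) (rule mono_comp_subset_verts[OF assms(2)])
      show "verts G \<subseteq> \<Union> (?comp ` verts G)"
        by (rule subsetI, rule UN_I, assumption, rule mono_comp_refl)
    qed
    have E: "{e \<in> edges G. \<exists>v\<in>verts G. e \<subseteq> ?comp v} = {e \<in> edges G. \<forall>u\<in>e. \<forall>v\<in>e. c u = c v}"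
      by (intro Collect_cong conj_cong refl) (rule edge_subset_mono_comp_iff[OF assms(2)])
    show ?thesis
      unfolding U_def mono_graph_def V E ..
  qed
  ultimately show ?thesis by simp
qed

text \<open>Double counting of the pairs of a colouring and an edge that it cuts. The factor
  \<open>1 / 2\<close> buys the strict inequality that contradicts the non-strict bound in
  \<open>eps_far\<close>.\<close>

lemma exists_few_cut_edges:
  fixes G :: lgraph and C :: "nat \<Rightarrow> nat \<Rightarrow> 'c"
  assumes "simple_graph G" "M > 0" "\<epsilon> > 0" "edges G \<noteq> {}"
    and cut: "\<And>u v. {u, v} \<in> edges G \<Longrightarrow> real (card {q. q < M \<and> C q u \<noteq> C q v}) \<le> \<epsilon> / 2 * real M"
  shows "\<exists>q<M. real (card (edges G - edges (mono_graph G (C q)))) < \<epsilon> * real (card (edges G))"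
proof (rule ccontr)
  assume "\<not> ?thesis"
  then have many: "\<epsilon> * real (card (edges G)) \<le> real (card (edges G - edges (mono_graph G (C q))))" if "q < M" for q
    using that by (meson not_less)
  have fin: "finite (edges G)"
  proof (rule finite_subset)
    show "edges G \<subseteq> Pow (verts G)" "finite (Pow (verts G))"
      using assms(1) by (auto simp: simple_graph_def)
  qed
  define bad where "bad q e \<longleftrightarrow> (\<exists>u\<in>e. \<exists>v\<in>e. C q u \<noteq> C q v)" for q e
  have "card (edges G - edges (mono_graph G (C q))) = (\<Sum>e\<in>edges G. of_bool (bad q e))" for q
  proof -
    have "edges G - edges (mono_graph G (C q)) = edges G \<inter> {e. bad q e}"
      by (auto simp: mono_graph_def bad_def)
    then show ?thesis
      using fin by (simp add: sum_of_bool_eq)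
  qed
  then have "(\<Sum>q<M. card (edges G - edges (mono_graph G (C q)))) = (\<Sum>q<M. \<Sum>e\<in>edges G. of_bool (bad q e))"
    by (simp only:)
  also have "\<dots> = (\<Sum>e\<in>edges G. \<Sum>q<M. of_bool (bad q e))"
    by (rule sum.swap)
  also have "\<dots> = (\<Sum>e\<in>edges G. card {q. q < M \<and> bad q e})"
    by (simp add: sum_of_bool_eq lessThan_def Collect_conj_eq)
  finally have sum: "(\<Sum>q<M. card (edges G - edges (mono_graph G (C q)))) = (\<Sum>e\<in>edges G. card {q. q < M \<and> bad q e})" .
  have bad: "real (card {q. q < M \<and> bad q e}) \<le> \<epsilon> / 2 * real M" if e: "e \<in> edges G" for e
  proof -
    obtain a b where ab: "e = {a, b}"
      using edge_pair[OF assms(1) e] .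
    have "{q. q < M \<and> bad q e} = {q. q < M \<and> C q a \<noteq> C q b}"
      unfolding ab bad_def by auto
    then show ?thesis using cut[of a b] e ab by simp
  qed
  have "real M * (\<epsilon> * real (card (edges G))) = (\<Sum>q<M. \<epsilon> * real (card (edges G)))"
    by simp
  also have "\<dots> \<le> (\<Sum>q<M. real (card (edges G - edges (mono_graph G (C q)))))"
    by (rule sum_mono) (use many in simp)
  also have "\<dots> = real (\<Sum>e\<in>edges G. card {q. q < M \<and> bad q e})"
    unfolding sum[symmetric] by simp
  also have "\<dots> \<le> (\<Sum>e\<in>edges G. \<epsilon> / 2 * real M)"
    unfolding of_nat_sum by (rule sum_mono) (rule bad)
  also have "\<dots> = real M * (\<epsilon> * real (card (edges G))) / 2"
    by simp
  finally have "real M * (\<epsilon> * real (card (edges G))) \<le> 0"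
    by linarith
  moreover have "real M * (\<epsilon> * real (card (edges G))) > 0"
    using assms(2-4) fin by (simp add: card_gt_0_iff)
  ultimately show False by linarith
qed

section \<open>The proof labelling scheme\<close>

text \<open>On certificates that are too short the values are arbitrary, which is harmless, since
  soundness is shown for all colourings.\<close>
definition decode :: "nat \<Rightarrow> cert_proof \<Rightarrow> nat \<Rightarrow> nat \<Rightarrow> bool list" where
  "decode s P q v = map (\<lambda>i. the (P v) ! (q * s + i)) [0..<s]"

definition check :: "real \<Rightarrow> nat \<Rightarrow> nat \<Rightarrow> nat \<Rightarrow> lgraph set \<Rightarrow> verifier" where
  "check \<epsilon> s M k \<P> G P v \<longleftrightarrow>
     (\<forall>q<M. mono_comp (adj_rel G) (decode s P q) v \<subseteq> gball G v k \<and>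
        induced G (mono_comp (adj_rel G) (decode s P q) v) \<in> \<P>) \<and>
     (\<forall>u. {v, u} \<in> edges G \<longrightarrow>
        real (card {q. q < M \<and> decode s P q v \<noteq> decode s P q u}) \<le> \<epsilon> / 2 * real M)"

text \<open>Radius \<open>Suc k\<close> also shows the neighbours of vertices at distance at most
  \<open>k\<close>, and so reveals whether a component really ends there.\<close>

definition local_check :: "real \<Rightarrow> nat \<Rightarrow> nat \<Rightarrow> nat \<Rightarrow> lgraph set \<Rightarrow> verifier" where
  "local_check \<epsilon> s M k \<P> G P v =
     check \<epsilon> s M k \<P> (induced G (gball G v (Suc k))) (P |` gball G v (Suc k)) v"

lemma local_verifier_local_check: "local_verifier (Suc k) (local_check \<epsilon> s M k \<P>)"
  unfolding local_verifier_def local_check_def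
  by (simp add: gball_induced_gball induced_induced)

text \<open>If the component of \<open>v\<close>, computed in the view or in \<open>G\<close>, lies
  within radius \<open>k\<close>, then both computations agree. Hence if they differ, both fail the
  radius test.\<close>

lemma local_check_iff:
  assumes G: "simple_graph G" and v: "v \<in> verts G"
  shows "local_check \<epsilon> s M k \<P> G P v \<longleftrightarrow> check \<epsilon> s M k \<P> G P v"
proof -
  define B where "B = gball G v (Suc k)"
  define H where "H = induced G B"
  have vB: "v \<in> B" unfolding B_def by (rule gball_refl[OF v])
  have kB: "gball G v k \<subseteq> B" unfolding B_def by (rule gball_mono) simp
  have ballH: "gball H v k = gball G v k"
    unfolding H_def B_def by (rule gball_induced_gball[OF G v]) simp
  have dec: "decode s (P |` B) q u = decode s P q u" if "u \<in> B" for q u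
    using that by (simp add: decode_def)
  have compH: "mono_comp (adj_rel H) (decode s (P |` B) q) v = mono_comp (adj_rel H) (decode s P q) v" for q
  proof (rule mono_comp_cong)
    show "simple_graph H" unfolding H_def by (rule simple_graph_induced[OF G])
    show "decode s (P |` B) q u = decode s P q u" if "u \<in> verts H" for u
      by (rule dec) (use that in \<open>simp add: H_def induced_def\<close>)
  qed
  have comp: "mono_comp (adj_rel H) c v \<subseteq> gball G v k \<and> induced H (mono_comp (adj_rel H) c v) \<in> \<P> \<longleftrightarrow>
      mono_comp (adj_rel G) c v \<subseteq> gball G v k \<and> induced G (mono_comp (adj_rel G) c v) \<in> \<P>" for c :: "nat \<Rightarrow> bool list"
  proof (cases "mono_comp (adj_rel H) c v = mono_comp (adj_rel G) c v")
    case True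
    have "B \<inter> mono_comp (adj_rel G) c v = mono_comp (adj_rel G) c v" if "mono_comp (adj_rel G) c v \<subseteq> gball G v k"
      using that kB by (intro Int_absorb1) (rule subset_trans)
    then show ?thesis
      unfolding True unfolding H_def induced_induced by (intro conj_cong refl) simp
  next
    case False
    have "\<not> mono_comp (adj_rel G) c v \<subseteq> gball G v k"
    proof
      assume "mono_comp (adj_rel G) c v \<subseteq> gball G v k"
      then have "mono_comp (adj_rel G) c v \<subseteq> B" using kB by (rule subset_trans)
      from mono_comp_induced_superset[OF vB this] show False
        using False unfolding H_def by simp
    qed
    moreover have "\<not> mono_comp (adj_rel H) c v \<subseteq> gball G v k"
    proof
      assume sub: "mono_comp (adj_rel H) c v \<subseteq> gball G v k"
      have "mono_comp (adj_rel (induced G B)) c v = mono_comp (adj_rel G) c v"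
      proof (rule mono_comp_induced_eq[OF vB])
        fix u w assume "u \<in> mono_comp (adj_rel (induced G B)) c v" "(u, w) \<in> adj_rel G"
        then show "w \<in> B"
          unfolding B_def using sub unfolding H_def B_def by (intro gball_step[OF G]) (rule subsetD)
      qed
      then show False using False unfolding H_def by simp
    qed
    ultimately show ?thesis by simp
  qed
  have edge: "{v, u} \<in> edges H \<longleftrightarrow> {v, u} \<in> edges G" for u
  proof -
    have "u \<in> B" if "{v, u} \<in> edges G"
      unfolding B_def by (rule gball_step[OF G gball_refl[OF v]]) (use that in \<open>simp add: adj_rel_def\<close>)
    then show ?thesis
      using vB by (auto simp: H_def induced_def)
  qed
  have uB: "u \<in> B" if "{v, u} \<in> edges G" for u
    using edge[of u] that by (auto simp: H_def induced_def)
  show ?thesis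
    unfolding local_check_def B_def[symmetric] H_def[symmetric] check_def ballH compH comp edge
    using uB by (simp add: dec[OF vB] dec cong: imp_cong)
qed

definition band_prover :: "nat \<Rightarrow> nat \<Rightarrow> prover" where
  "band_prover l s G = (\<lambda>v. if v \<in> verts G
     then Some (map (\<lambda>j. band_colour (adj_rel G) l s (j div s) v ! (j mod s)) [0..<l ^ s * s])
     else None)"

lemma decode_band_prover:
  assumes "v \<in> verts G" "q < l ^ s"
  shows "decode s (band_prover l s G) q v = band_colour (adj_rel G) l s q v"
proof (rule nth_equalityI)
  show "length (decode s (band_prover l s G) q v) = length (band_colour (adj_rel G) l s q v)"
    by (simp add: decode_def length_band_colour)
  fix i assume "i < length (decode s (band_prover l s G) q v)"
  then have i: "i < s" by (simp add: decode_def)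
  have "q * s + i < Suc q * s" using i by simp
  also have "\<dots> \<le> l ^ s * s" using assms(2) by (intro mult_le_mono1) simp
  finally have "q * s + i < l ^ s * s" .
  then show "decode s (band_prover l s G) q v ! i = band_colour (adj_rel G) l s q v ! i"
    using assms i by (simp add: decode_def band_prover_def)
qed

section \<open>Completeness and soundness\<close>

lemma reachable_verts:
  assumes "simple_graph G" "connected_graph G" "v \<in> verts G"
  shows "{u. (v, u) \<in> (adj_rel G)\<^sup>*} = verts G"
proof
  show "{u. (v, u) \<in> (adj_rel G)\<^sup>*} \<subseteq> verts G"
  proof safe
    fix u assume "(v, u) \<in> (adj_rel G)\<^sup>*"
    then show "u \<in> verts G"
      by induction (use assms(3) adj_rel_verts[OF assms(1)] in auto)
  qed
  show "verts G \<subseteq> {u. (v, u) \<in> (adj_rel G)\<^sup>*}"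
  proof (intro subsetI CollectI)
    fix u assume "u \<in> verts G"
    then show "(v, u) \<in> (adj_rel G)\<^sup>*"
      using assms(2,3) unfolding connected_graph_def by blast
  qed
qed

text \<open>The bound for chains is applied with \<open>g\<close> the distance in \<open>G\<close>
  from \<open>v\<close>; connectedness lets the chain start from all of
  \<open>verts G\<close>.\<close>

lemma band_colour_weak_diameter:
  fixes G :: lgraph
  assumes G: "simple_graph G" "connected_graph G" "v \<in> verts G"
    and H: "simple_graph H" "\<not> minor H G" "card (verts H) \<le> s" "s \<ge> 2" and "l > 0"
  shows "mono_comp (adj_rel G) (band_colour (adj_rel G) l s q) v \<subseteq> gball G v (s * (6 * l * Suc s + 1))"
    (is "?V \<subseteq> _")
proof
  let ?E = "adj_rel G"
  define d where "d u = (LEAST n. (v, u) \<in> ?E ^^ n)" for u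
  have bfs: "bfs ?E (verts G) v d"
    using bfs_Least_relpow[OF sym_adj_rel[of G], of v] unfolding reachable_verts[OF G] d_def[abs_def] .
  have Lip: "d y \<le> Suc (d u)" if "(u, y) \<in> ?E" for u y
    using bfs adj_rel_verts[OF G(1) that] that unfolding bfs_def by blast
  fix u assume u: "u \<in> ?V"
  have uG: "u \<in> verts G" using mono_comp_subset_verts[OF G(1,3)] u by (rule subsetD)
  have "int (d u) \<le> int (s * (6 * l * Suc s + 1))"
  proof (rule band_chain_weak_diameter[where g = "\<lambda>u. int (d u)", OF G(1) H \<open>l > 0\<close>])
    have "mono_rel ?E (band_colour ?E l 0 0) = ?E"
      by (auto simp: mono_rel_def)
    then have "mono_comp ?E (band_colour ?E l 0 0) v = verts G"
      unfolding mono_comp_def by (simp only: reachable_verts[OF G])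
    then show "band_chain ?E l (verts G) s ?V"
      by (rule band_chain_band_colour[OF sym_adj_rel \<open>l > 0\<close>])
    show "conn ?E ?V" by (rule conn_mono_comp[OF sym_adj_rel])
    show "v \<in> ?V" by (rule mono_comp_refl)
    show "u \<in> ?V" by (rule u)
    show "int (d v) = 0" by (simp add: d_def Least_eq_0)
    show "\<bar>int (d u) - int (d y)\<bar> \<le> 1" if "(u, y) \<in> ?E" for u y
      using Lip[OF that] Lip[OF symD[OF sym_adj_rel that]] by linarith
  qed
  then have le: "d u \<le> s * (6 * l * Suc s + 1)" by (simp only: of_nat_le_iff)
  have "(v, u) \<in> ?E\<^sup>*" using reachable_verts[OF G] uG by blast
  then have "\<exists>n. (v, u) \<in> ?E ^^ n" by (rule rtrancl_imp_relpow)
  then have "(v, u) \<in> ?E ^^ d u" unfolding d_def by (rule LeastI_ex)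
  then show "u \<in> gball G v (s * (6 * l * Suc s + 1))"
    by (rule gballI[OF uG le])
qed

text \<open>Monotonicity puts every induced subgraph of \<open>G\<close> into \<open>\<P>\<close>,
  and an edge is cut in a fraction of at most \<open>s / l\<close> of the colourings.\<close>

lemma check_band_prover:
  fixes G :: lgraph
  assumes G: "simple_graph G" "connected_graph G" "v \<in> verts G" "G \<in> \<P>" and "monotone_property \<P>"
    and H: "simple_graph H" "\<not> minor H G" "card (verts H) \<le> s" "s \<ge> 2" and "l > 0"
    and l: "real s \<le> \<epsilon> / 2 * real l"
  shows "check \<epsilon> s (l ^ s) (s * (6 * l * Suc s + 1)) \<P> G (band_prover l s G) v"
  unfolding check_def
proof (intro conjI allI impI)
  let ?E = "adj_rel G"
  fix q assume q: "q < l ^ s"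
  have "mono_comp ?E (decode s (band_prover l s G) q) v = mono_comp ?E (band_colour ?E l s q) v"
    by (rule mono_comp_cong[OF G(1)]) (rule decode_band_prover[OF _ q])
  then show "mono_comp ?E (decode s (band_prover l s G) q) v \<subseteq> gball G v (s * (6 * l * Suc s + 1))"
    using band_colour_weak_diameter[OF G(1-3) H \<open>l > 0\<close>] by (simp only:)
  show "induced G (mono_comp ?E (decode s (band_prover l s G) q) v) \<in> \<P>"
    using assms(5) G(4) subgraph_induced[OF G(1)] unfolding monotone_property_def by blast
next
  let ?E = "adj_rel G"
  fix u assume vu: "{v, u} \<in> edges G"
  then have E: "(v, u) \<in> ?E" by (simp add: adj_rel_def)
  have u: "u \<in> verts G" using adj_rel_verts[OF G(1) E] ..
  define N where "N = card {q. q < l ^ s \<and> band_colour ?E l s q v \<noteq> band_colour ?E l s q u}"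
  have "{q. q < l ^ s \<and> decode s (band_prover l s G) q v \<noteq> decode s (band_prover l s G) q u} =
      {q. q < l ^ s \<and> band_colour ?E l s q v \<noteq> band_colour ?E l s q u}"
    by (intro Collect_cong conj_cong refl) (simp add: decode_band_prover G(3) u)
  moreover have "real N \<le> \<epsilon> / 2 * real (l ^ s)"
  proof -
    have "N * l \<le> s * l ^ s"
      unfolding N_def by (rule card_separating_band_colours[OF sym_adj_rel \<open>l > 0\<close> E])
    then have "real N * real l \<le> real s * real (l ^ s)"
      by (metis of_nat_le_iff of_nat_mult)
    also have "\<dots> \<le> \<epsilon> / 2 * real l * real (l ^ s)"
      using l by (rule mult_right_mono) simp
    finally have "real N * real l \<le> (\<epsilon> / 2 * real (l ^ s)) * real l"
      by (simp only: ac_simps)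
    then show ?thesis
      using \<open>l > 0\<close> by (simp only: mult_le_cancel_right_pos of_nat_0_less_iff)
  qed
  ultimately show "real (card {q. q < l ^ s \<and> decode s (band_prover l s G) q v \<noteq> decode s (band_prover l s G) q u})
      \<le> \<epsilon> / 2 * real (l ^ s)"
    by (simp only: N_def)
qed

text \<open>If all vertices accept, each \<open>mono_graph\<close> lies in \<open>\<P>\<close> by
  summability and arises by deletions only; averaging finds one with too few deletions for
  \<open>G\<close> to be far.\<close>

lemma check_sound:
  assumes "simple_graph G" "verts G \<noteq> {}" "summable_property \<P>" "M > 0" "\<epsilon> > 0" "eps_far \<epsilon> \<P> G"
  shows "\<exists>v\<in>verts G. \<not> check \<epsilon> s M k \<P> G P v"
proof (rule ccontr)
  assume "\<not> ?thesis"
  then have chk: "check \<epsilon> s M k \<P> G P v" if "v \<in> verts G" for v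
    using that by blast
  let ?m = "\<lambda>q. mono_graph G (decode s P q)"
  have mP: "?m q \<in> \<P>" if "q < M" for q
    by (rule mono_graph_in_summable[OF assms(3,1,2)]) (use chk that in \<open>simp add: check_def\<close>)
  have far: "\<epsilon> * real (card (edges G)) \<le> real (card (edges G - edges (?m q)))" if "q < M" for q
  proof -
    have "verts (?m q) = verts G" and diff: "edges (?m q) - edges G = {}"
      by (auto simp: mono_graph_def)
    then have "\<epsilon> * real (card (edges G)) \<le> real (card (edges G - edges (?m q) \<union> (edges (?m q) - edges G)))"
      using assms(6) mP[OF that] unfolding eps_far_def by blast
    then show ?thesis unfolding diff by simp
  qed
  \<comment> \<open>Averaging needs an edge. Without edges nothing is deleted and \<open>G\<close>
    itself would lie in \<open>\<P>\<close>.\<close>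
  have "edges G \<noteq> {}"
  proof
    assume "edges G = {}"
    then have "?m 0 = G" by (simp add: mono_graph_def)
    then show False
      using mP[OF \<open>M > 0\<close>] assms(6) by (simp add: eps_far_def)
  qed
  moreover have "real (card {q. q < M \<and> decode s P q u \<noteq> decode s P q v}) \<le> \<epsilon> / 2 * real M"
    if "{u, v} \<in> edges G" for u v
  proof -
    have "u \<in> verts G" using assms(1) that by (auto simp: simple_graph_def)
    then show ?thesis using chk[of u] that unfolding check_def by simp
  qed
  ultimately have "\<exists>q<M. real (card (edges G - edges (?m q))) < \<epsilon> * real (card (edges G))"
    by (rule exists_few_cut_edges[OF assms(1,4,5)])
  then show False using far by force
qed

theorem theorem4:
  fixes \<epsilon> :: real and p :: "real poly" and \<G> \<P> :: "lgraph set"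
  assumes "\<epsilon> > 0"
    and "graph_class \<G>" and "minor_closed \<G>" and "proper_class \<G>"
    and "property_of \<P> \<G>" and "monotone_property \<P>" and "summable_property \<P>"
  shows "\<exists>(r::nat) (K::nat) prv \<A>. approx_pls p \<epsilon> \<P> r prv \<A> \<and>
           (\<forall>n. scheme_complexity p \<P> prv n \<le> enat K)"
proof -
  obtain H :: lgraph where H: "simple_graph H" "H \<notin> \<G>"
    using assms(4) unfolding proper_class_def by blast
  have no_minor: "\<not> minor H G" if "G \<in> \<P>" for G
    using assms(3,5) H(2) that unfolding minor_closed_def property_of_def by blast
  \<comment> \<open>The summand \<open>2\<close> secures \<open>s \<ge> 2\<close>: the extension
    step needs two branch sets to keep the band away from the root.\<close>
  define s where "s = card (verts H) + 2"
  have s: "card (verts H) \<le> s" "s \<ge> 2" by (simp_all add: s_def)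
  \<comment> \<open>This choice brings the fraction \<open>s / l\<close> of colourings cutting an
    edge down to at most \<open>\<epsilon> / 2\<close>.\<close>
  obtain l :: nat where "2 * real s / \<epsilon> < real l"
    using reals_Archimedean2 by blast
  then have l: "real s \<le> \<epsilon> / 2 * real l"
    using assms(1) by (simp add: field_simps)
  have "l > 0"
  proof (rule ccontr)
    assume "\<not> l > 0"
    then show False using l s(2) by simp
  qed
  define k where "k = s * (6 * l * Suc s + 1)"
  define \<A> where "\<A> = local_check \<epsilon> s (l ^ s) k \<P>"
  have "approx_pls p \<epsilon> \<P> (Suc k) (band_prover l s) \<A>"
    unfolding approx_pls_def
  proof (intro conjI ballI allI impI)
    show "local_verifier (Suc k) \<A>"
      unfolding \<A>_def by (rule local_verifier_local_check)
  next
    fix G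
    show "proof_for G (band_prover l s G)"
      by (auto simp: proof_for_def band_prover_def split: if_splits)
  next
    fix G v assume G: "G \<in> \<P>" "certification_instance p G" and v: "v \<in> verts G"
    have sG: "simple_graph G" "connected_graph G"
      using G(2) by (simp_all add: certification_instance_def)
    show "\<A> G (band_prover l s G) v"
      unfolding \<A>_def local_check_iff[OF sG(1) v] k_def
      by (rule check_band_prover[OF sG v G(1) assms(6) H(1) no_minor[OF G(1)] s \<open>l > 0\<close> l])
  next
    fix G P assume G: "certification_instance p G \<and> eps_far \<epsilon> \<P> G"
    then have sG: "simple_graph G" "verts G \<noteq> {}" "eps_far \<epsilon> \<P> G"
      by (simp_all add: certification_instance_def connected_graph_def)
    have "\<exists>v\<in>verts G. \<not> check \<epsilon> s (l ^ s) k \<P> G P v"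
      by (rule check_sound[OF sG(1,2) assms(7) _ assms(1) sG(3)]) (simp add: \<open>l > 0\<close>)
    then show "\<exists>v\<in>verts G. \<not> \<A> G P v"
      unfolding \<A>_def using local_check_iff[OF sG(1)] by blast
  qed
  moreover have "scheme_complexity p \<P> (band_prover l s) n \<le> enat (l ^ s * s)" for n
    unfolding scheme_complexity_def
  proof (rule SUP_least)
    fix G assume "G \<in> {G \<in> \<P>. certification_instance p G \<and> card (verts G) = n}"
    then have G: "finite (verts G)" "verts G \<noteq> {}"
      by (simp_all add: certification_instance_def connected_graph_def simple_graph_def)
    have "proof_size G (band_prover l s G) \<le> l ^ s * s"
      unfolding proof_size_def using G by (intro Max.boundedI) (auto simp: band_prover_def)
    then show "enat (proof_size G (band_prover l s G)) \<le> enat (l ^ s * s)" by simp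
  qed
  ultimately show ?thesis by blast
qed

end
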